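(* Let $\Gamma$ be a green Veldkamp quadrangle and let $\bar\Gamma$ be the graph with local opposition relations defined below. Then $\bar\Gamma$ is a flat green Veldkamp quadrangle (with point set $\bar P$ and line set $\bar L$). Moreover, $\Gamma$ is flat if and only if all classes $[a]$ ($a\in P$) and $[x]$ ($x\in L$) are singletons, i.e. $\bar\Gamma$ can be identified with $\Gamma$. Furthermore, if $\Gamma$ is $k$-plump for some $k\ge3$, then so is $\bar\Gamma$.
   Context: A graph is a pair $(V,E)$ with $E$ a set of $2$-element subsets of $V$; $\Gamma_v$ is the set of neighbors of $v$. An $s$-path is a sequence $(x_0,\dots,x_s)$ of vertices with consecutive vertices adjacent and $x_{i-2}\ne x_i$ for $i\in[2,s]$; ${\rm dist}$ is graph distance. A closed $s$-path is an $s$-path with $s\ge3$ whose first and last vertices coincide; an $s$-circuit is the subgraph determined by a closed $s$-path. An opposition relation on a set $X$ is a symmetric anti-reflexive relation; trivial if any two distinct elements are related; $k$-plump if for every $S\subseteq X$ with $|S|\le k$ some element of $X$ is related to all elements of $S$. A Veldkamp graph is a graph with a $2$-plump opposition relation $\equiv_v$ on $\Gamma_v$ for each vertex $v$; it is $k$-plump if all $\equiv_v$ are. A path $(v_0,\dots,v_s)$ is straight if $v_{i-1}\equiv_{v_i}v_{i+1}$ for all $i\in[1,s-1]$; a circuit is straight if every path in it is straight. A Veldkamp $n$-gon ($n\ge2$) is a Veldkamp graph satisfying (VP1) connected and bipartite; (VP2) for each $k\in[1,n-1]$ each straight $k$-path is the unique straight path between its endpoints of length at most $k$; (VP3) every straight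 $(n+1)$-path lies in a straight $2n$-circuit. A root is a straight $n$-path; two vertices are opposite if there is a root between them; $x^{\rm op}$ is the set of vertices opposite $x$; the polygon is flat if $x^{\rm op}=y^{\rm op}$ implies $x=y$. A Veldkamp quadrangle is a Veldkamp $4$-gon, with bipartition classes called points $P$ and lines $L$; it is green if $\equiv_x$ is trivial for every line $x$. A weed is a non-straight $4$-path $(a,x,b,y,c)$ with $a,b,c\in P$ and ${\rm dist}(a,c)=4$. For $a,b\in P$, $a\simeq b$ means $a=b$ or there is a weed from $a$ to $b$; this is an equivalence relation on $P$, with class $[a]$. For $x,y\in L$, $x\sim y$ means some weed contains both $x$ and $y$; $\approx$ is the reflexive-transitive closure of $\sim$, with class $[x]$. The graph $\bar\Gamma$: its vertex set is the disjoint union of $\bar P=\{[a]\mid a\in P\}$ and $\bar L=\{[x]\mid x\in L\}$; $[a]$ and $[x]$ are adjacent iff some element of $[a]$ is adjacent in $\Gamma$ to some element of $[x]$. Two neighbors of $[x]\in\bar L$ are opposite at $[x]$ iff they are distinct; two neighbors $[x],[y]$ of $[a]\in\bar P$ are opposite at $[a]$ iff there is a point $b\in[a]$ such that every line in $\Gamma_b\cap[x]$ is opposite (at $b$) every line in $\Gamma_b\cap[y]$. *)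

theory Defs
  imports Main
begin

text \<open>A graph is given by a vertex set V and an adjacency predicate adj
(symmetric, irreflexive, supported on V). The local opposition relation at
a vertex v is opp v, a relation on the neighbourhood of v.\<close>

definition is_graph :: "'v set \<Rightarrow> ('v \<Rightarrow> 'v \<Rightarrow> bool) \<Rightarrow> bool" where
  "is_graph V adj \<longleftrightarrow> (\<forall>x y. adj x y \<longrightarrow> x \<in> V \<and> y \<in> V \<and> x \<noteq> y \<and> adj y x)"

definition nbrs :: "('v \<Rightarrow> 'v \<Rightarrow> bool) \<Rightarrow> 'v \<Rightarrow> 'v set" where
  "nbrs adj v = {u. adj v u}"

definition opposition_rel :: "'a set \<Rightarrow> ('a \<Rightarrow> 'a \<Rightarrow> bool) \<Rightarrow> bool" where
  "opposition_rel X R \<longleftrightarrow> (\<forall>x y. R x y \<longrightarrow> x \<in> X \<and> y \<in> X) \<and>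
     (\<forall>x y. R x y \<longrightarrow> R y x) \<and> (\<forall>x. \<not> R x x)"

definition trivial_rel :: "'a set \<Rightarrow> ('a \<Rightarrow> 'a \<Rightarrow> bool) \<Rightarrow> bool" where
  "trivial_rel X R \<longleftrightarrow> (\<forall>x\<in>X. \<forall>y\<in>X. x \<noteq> y \<longrightarrow> R x y)"

definition plump :: "nat \<Rightarrow> 'a set \<Rightarrow> ('a \<Rightarrow> 'a \<Rightarrow> bool) \<Rightarrow> bool" where
  "plump k X R \<longleftrightarrow> (\<forall>S. S \<subseteq> X \<and> finite S \<and> card S \<le> k \<longrightarrow> (\<exists>x\<in>X. \<forall>s\<in>S. R x s))"

definition veldkamp_graph :: "'v set \<Rightarrow> ('v \<Rightarrow> 'v \<Rightarrow> bool) \<Rightarrow> ('v \<Rightarrow> 'v \<Rightarrow> 'v \<Rightarrow> bool) \<Rightarrow> bool" where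
  "veldkamp_graph V adj opp \<longleftrightarrow> is_graph V adj \<and>
     (\<forall>v\<in>V. opposition_rel (nbrs adj v) (opp v) \<and> plump 2 (nbrs adj v) (opp v))"

definition plump_graph :: "nat \<Rightarrow> 'v set \<Rightarrow> ('v \<Rightarrow> 'v \<Rightarrow> bool) \<Rightarrow> ('v \<Rightarrow> 'v \<Rightarrow> 'v \<Rightarrow> bool) \<Rightarrow> bool" where
  "plump_graph k V adj opp \<longleftrightarrow> (\<forall>v\<in>V. plump k (nbrs adj v) (opp v))"

definition is_path :: "'v set \<Rightarrow> ('v \<Rightarrow> 'v \<Rightarrow> bool) \<Rightarrow> nat \<Rightarrow> 'v list \<Rightarrow> bool" where
  "is_path V adj s xs \<longleftrightarrow> length xs = s + 1 \<and> set xs \<subseteq> V \<and>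
     (\<forall>i<s. adj (xs ! i) (xs ! (i + 1))) \<and>
     (\<forall>i. 2 \<le> i \<and> i \<le> s \<longrightarrow> xs ! (i - 2) \<noteq> xs ! i)"

definition straight :: "('v \<Rightarrow> 'v \<Rightarrow> 'v \<Rightarrow> bool) \<Rightarrow> 'v list \<Rightarrow> bool" where
  "straight opp xs \<longleftrightarrow> (\<forall>i. 1 \<le> i \<and> i + 1 < length xs \<longrightarrow> opp (xs ! i) (xs ! (i - 1)) (xs ! (i + 1)))"

definition walk :: "('v \<Rightarrow> 'v \<Rightarrow> bool) \<Rightarrow> 'v list \<Rightarrow> bool" where
  "walk adj xs \<longleftrightarrow> xs \<noteq> [] \<and> (\<forall>i. i + 1 < length xs \<longrightarrow> adj (xs ! i) (xs ! (i + 1)))"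

definition gdist :: "('v \<Rightarrow> 'v \<Rightarrow> bool) \<Rightarrow> 'v \<Rightarrow> 'v \<Rightarrow> nat" where
  "gdist adj a b = (LEAST n. \<exists>xs. walk adj xs \<and> length xs = n + 1 \<and> hd xs = a \<and> last xs = b)"

definition connected_graph :: "'v set \<Rightarrow> ('v \<Rightarrow> 'v \<Rightarrow> bool) \<Rightarrow> bool" where
  "connected_graph V adj \<longleftrightarrow> V \<noteq> {} \<and>
     (\<forall>x\<in>V. \<forall>y\<in>V. \<exists>xs. walk adj xs \<and> hd xs = x \<and> last xs = y)"

definition bipartite_graph :: "'v set \<Rightarrow> ('v \<Rightarrow> 'v \<Rightarrow> bool) \<Rightarrow> bool" where
  "bipartite_graph V adj \<longleftrightarrow> (\<exists>A B. A \<union> B = V \<and> A \<inter> B = {} \<and>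
     (\<forall>x y. adj x y \<longrightarrow> (x \<in> A \<longleftrightarrow> y \<in> B)))"

definition closed_path :: "'v set \<Rightarrow> ('v \<Rightarrow> 'v \<Rightarrow> bool) \<Rightarrow> nat \<Rightarrow> 'v list \<Rightarrow> bool" where
  "closed_path V adj s cs \<longleftrightarrow> s \<ge> 3 \<and> is_path V adj s cs \<and> hd cs = last cs"

definition circuit_edge :: "'v list \<Rightarrow> 'v \<Rightarrow> 'v \<Rightarrow> bool" where
  "circuit_edge cs u v \<longleftrightarrow> (\<exists>i. i + 1 < length cs \<and>
     ((u = cs ! i \<and> v = cs ! (i + 1)) \<or> (v = cs ! i \<and> u = cs ! (i + 1))))"

definition path_in_circuit :: "'v list \<Rightarrow> nat \<Rightarrow> 'v list \<Rightarrow> bool" where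
  "path_in_circuit cs m ys \<longleftrightarrow> is_path (set cs) (circuit_edge cs) m ys"

definition straight_circuit :: "('v \<Rightarrow> 'v \<Rightarrow> 'v \<Rightarrow> bool) \<Rightarrow> 'v list \<Rightarrow> bool" where
  "straight_circuit opp cs \<longleftrightarrow> (\<forall>m ys. path_in_circuit cs m ys \<longrightarrow> straight opp ys)"

definition veldkamp_ngon :: "'v set \<Rightarrow> ('v \<Rightarrow> 'v \<Rightarrow> bool) \<Rightarrow> ('v \<Rightarrow> 'v \<Rightarrow> 'v \<Rightarrow> bool) \<Rightarrow> nat \<Rightarrow> bool" where
  "veldkamp_ngon V adj opp n \<longleftrightarrow> n \<ge> 2 \<and> veldkamp_graph V adj opp \<and>
     \<comment> \<open>VP1\<close>
     connected_graph V adj \<and> bipartite_graph V adj \<and>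
     \<comment> \<open>VP2\<close>
     (\<forall>k. 1 \<le> k \<and> k \<le> n - 1 \<longrightarrow> (\<forall>xs. is_path V adj k xs \<and> straight opp xs \<longrightarrow>
        (\<forall>m ys. m \<le> k \<and> is_path V adj m ys \<and> straight opp ys \<and>
           hd ys = hd xs \<and> last ys = last xs \<longrightarrow> ys = xs))) \<and>
     \<comment> \<open>VP3\<close>
     (\<forall>xs. is_path V adj (n + 1) xs \<and> straight opp xs \<longrightarrow>
        (\<exists>cs. closed_path V adj (2 * n) cs \<and> straight_circuit opp cs \<and>
              path_in_circuit cs (n + 1) xs))"

definition opposite :: "'v set \<Rightarrow> ('v \<Rightarrow> 'v \<Rightarrow> bool) \<Rightarrow> ('v \<Rightarrow> 'v \<Rightarrow> 'v \<Rightarrow> bool) \<Rightarrow> nat \<Rightarrow> 'v \<Rightarrow> 'v \<Rightarrow> bool" where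
  "opposite V adj opp n x y \<longleftrightarrow> (\<exists>xs. is_path V adj n xs \<and> straight opp xs \<and> hd xs = x \<and> last xs = y)"

definition op_set :: "'v set \<Rightarrow> ('v \<Rightarrow> 'v \<Rightarrow> bool) \<Rightarrow> ('v \<Rightarrow> 'v \<Rightarrow> 'v \<Rightarrow> bool) \<Rightarrow> nat \<Rightarrow> 'v \<Rightarrow> 'v set" where
  "op_set V adj opp n x = {y. opposite V adj opp n x y}"

definition flat :: "'v set \<Rightarrow> ('v \<Rightarrow> 'v \<Rightarrow> bool) \<Rightarrow> ('v \<Rightarrow> 'v \<Rightarrow> 'v \<Rightarrow> bool) \<Rightarrow> nat \<Rightarrow> bool" where
  "flat V adj opp n \<longleftrightarrow> (\<forall>x\<in>V. \<forall>y\<in>V. op_set V adj opp n x = op_set V adj opp n y \<longrightarrow> x = y)"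

definition veldkamp_quadrangle :: "'v set \<Rightarrow> ('v \<Rightarrow> 'v \<Rightarrow> bool) \<Rightarrow> ('v \<Rightarrow> 'v \<Rightarrow> 'v \<Rightarrow> bool) \<Rightarrow> 'v set \<Rightarrow> 'v set \<Rightarrow> bool" where
  "veldkamp_quadrangle V adj opp P L \<longleftrightarrow> veldkamp_ngon V adj opp 4 \<and>
     P \<union> L = V \<and> P \<inter> L = {} \<and> (\<forall>x y. adj x y \<longrightarrow> (x \<in> P \<longleftrightarrow> y \<in> L))"

definition green :: "('v \<Rightarrow> 'v \<Rightarrow> bool) \<Rightarrow> ('v \<Rightarrow> 'v \<Rightarrow> 'v \<Rightarrow> bool) \<Rightarrow> 'v set \<Rightarrow> bool" where
  "green adj opp L \<longleftrightarrow> (\<forall>x\<in>L. trivial_rel (nbrs adj x) (opp x))"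

definition weed :: "'v set \<Rightarrow> ('v \<Rightarrow> 'v \<Rightarrow> bool) \<Rightarrow> ('v \<Rightarrow> 'v \<Rightarrow> 'v \<Rightarrow> bool) \<Rightarrow> 'v set \<Rightarrow> 'v list \<Rightarrow> bool" where
  "weed V adj opp P w \<longleftrightarrow> is_path V adj 4 w \<and> \<not> straight opp w \<and>
     w ! 0 \<in> P \<and> w ! 2 \<in> P \<and> w ! 4 \<in> P \<and> gdist adj (w ! 0) (w ! 4) = 4"

definition pequiv :: "'v set \<Rightarrow> ('v \<Rightarrow> 'v \<Rightarrow> bool) \<Rightarrow> ('v \<Rightarrow> 'v \<Rightarrow> 'v \<Rightarrow> bool) \<Rightarrow> 'v set \<Rightarrow> 'v \<Rightarrow> 'v \<Rightarrow> bool" where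
  "pequiv V adj opp P a b \<longleftrightarrow> a = b \<or> (\<exists>w. weed V adj opp P w \<and> w ! 0 = a \<and> w ! 4 = b)"

definition pclass :: "'v set \<Rightarrow> ('v \<Rightarrow> 'v \<Rightarrow> bool) \<Rightarrow> ('v \<Rightarrow> 'v \<Rightarrow> 'v \<Rightarrow> bool) \<Rightarrow> 'v set \<Rightarrow> 'v \<Rightarrow> 'v set" where
  "pclass V adj opp P a = {b\<in>P. pequiv V adj opp P a b}"

definition lsim :: "'v set \<Rightarrow> ('v \<Rightarrow> 'v \<Rightarrow> bool) \<Rightarrow> ('v \<Rightarrow> 'v \<Rightarrow> 'v \<Rightarrow> bool) \<Rightarrow> 'v set \<Rightarrow> 'v set \<Rightarrow> 'v \<Rightarrow> 'v \<Rightarrow> bool" where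
  "lsim V adj opp P L x y \<longleftrightarrow> x \<in> L \<and> y \<in> L \<and> (\<exists>w. weed V adj opp P w \<and> x \<in> set w \<and> y \<in> set w)"

definition lclass :: "'v set \<Rightarrow> ('v \<Rightarrow> 'v \<Rightarrow> bool) \<Rightarrow> ('v \<Rightarrow> 'v \<Rightarrow> 'v \<Rightarrow> bool) \<Rightarrow> 'v set \<Rightarrow> 'v set \<Rightarrow> 'v \<Rightarrow> 'v set" where
  "lclass V adj opp P L x = {y\<in>L. (lsim V adj opp P L)\<^sup>*\<^sup>* x y}"

definition Pbar :: "'v set \<Rightarrow> ('v \<Rightarrow> 'v \<Rightarrow> bool) \<Rightarrow> ('v \<Rightarrow> 'v \<Rightarrow> 'v \<Rightarrow> bool) \<Rightarrow> 'v set \<Rightarrow> 'v set set" where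
  "Pbar V adj opp P = pclass V adj opp P ` P"

definition Lbar :: "'v set \<Rightarrow> ('v \<Rightarrow> 'v \<Rightarrow> bool) \<Rightarrow> ('v \<Rightarrow> 'v \<Rightarrow> 'v \<Rightarrow> bool) \<Rightarrow> 'v set \<Rightarrow> 'v set \<Rightarrow> 'v set set" where
  "Lbar V adj opp P L = lclass V adj opp P L ` L"

text \<open>The vertex set of the quotient graph; classes are nonempty subsets of the
disjoint sets P resp. L, hence Pbar and Lbar are disjoint.\<close>

definition Vbar :: "'v set \<Rightarrow> ('v \<Rightarrow> 'v \<Rightarrow> bool) \<Rightarrow> ('v \<Rightarrow> 'v \<Rightarrow> 'v \<Rightarrow> bool) \<Rightarrow> 'v set \<Rightarrow> 'v set \<Rightarrow> 'v set set" where
  "Vbar V adj opp P L = Pbar V adj opp P \<union> Lbar V adj opp P L"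

definition adjbar :: "'v set \<Rightarrow> ('v \<Rightarrow> 'v \<Rightarrow> bool) \<Rightarrow> ('v \<Rightarrow> 'v \<Rightarrow> 'v \<Rightarrow> bool) \<Rightarrow> 'v set \<Rightarrow> 'v set \<Rightarrow> 'v set \<Rightarrow> 'v set \<Rightarrow> bool" where
  "adjbar V adj opp P L A X \<longleftrightarrow>
     ((A \<in> Pbar V adj opp P \<and> X \<in> Lbar V adj opp P L) \<or> (A \<in> Lbar V adj opp P L \<and> X \<in> Pbar V adj opp P)) \<and>
     (\<exists>a\<in>A. \<exists>x\<in>X. adj a x)"

definition oppbar :: "'v set \<Rightarrow> ('v \<Rightarrow> 'v \<Rightarrow> bool) \<Rightarrow> ('v \<Rightarrow> 'v \<Rightarrow> 'v \<Rightarrow> bool) \<Rightarrow> 'v set \<Rightarrow> 'v set \<Rightarrow> 'v set \<Rightarrow> 'v set \<Rightarrow> 'v set \<Rightarrow> bool" where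
  "oppbar V adj opp P L A X Y \<longleftrightarrow>
     adjbar V adj opp P L A X \<and> adjbar V adj opp P L A Y \<and>
     ((A \<in> Lbar V adj opp P L \<and> X \<noteq> Y) \<or>
      (A \<in> Pbar V adj opp P \<and>
        (\<exists>b\<in>A. \<forall>u\<in>nbrs adj b \<inter> X. \<forall>v\<in>nbrs adj b \<inter> Y. opp b u v)))"

end

theory Submission
  imports Defs
begin

text \<open>
  A straight path of length 4 between points makes them opposite; call points that are not
  opposite perpendicular. A weed joins exactly the pairs of points that are neither collinear nor
  opposite, and its ends have the same opposite points. Hence, modulo equality of opposite sets,
  the points and lines form a nondegenerate polar space in the sense of Buekenhout and Shult: a
  point is perpendicular to exactly one or to all points of a line. As in their theory, a line
  is determined by any two of its points; in terms of \<open>\<Gamma>\<close> this says that two lines with the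
  same perpendicular points meet the same point classes. The line classes of the quotient are the
  classes for that relation, so opposition in the quotient can be computed on representatives.
\<close>

section \<open>The first-order geometry\<close>

text \<open>Since opposition at lines is trivial, straightness is a condition at points only, up to
  backtracking. The Veldkamp axioms thus become first-order: (VP2) gives \<open>unique_line\<close>
  and \<open>unique_proj\<close>, (VP3) gives \<open>close_path\<close>, plumpness gives
  \<open>plump2\<close> and \<open>third_point\<close>. These axioms are verified again for the
  quotient and then translated back to (VP1)-(VP3), so the geometry never handles circuits. The
  obstacle in the translation is that a closed path may repeat vertices; (VP2) has to exclude this
  before the neighbours of a vertex in a circuit are known. Inside the geometry plumpness is the
  engine. \<open>close_path\<close> exchanges the first line of a root only for a line opposite to
  it, but any two lines on a point have a common opposite, so two exchanges reach every line. The
  line classes are generated by chains of weeds of no a priori bounded length. The relation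
  \<open>leq\<close> avoids chains, being an equivalence by its form; the work lies in relating it
  to points and to weeds.\<close>

locale straight_geometry =
  fixes on :: "'p \<Rightarrow> 'l \<Rightarrow> bool" and opl :: "'p \<Rightarrow> 'l \<Rightarrow> 'l \<Rightarrow> bool"
  assumes opl_on: "opl p x y \<Longrightarrow> on p x"
    and opl_sym: "opl p x y \<Longrightarrow> opl p y x"
    and opl_irrefl: "\<not> opl p x x"
    and unique_line: "\<lbrakk>on p x; on q x; on p y; on q y; p \<noteq> q\<rbrakk> \<Longrightarrow> x = y"
    and unique_proj: "\<lbrakk>on p x; p \<noteq> q; opl q x y; on p x'; p \<noteq> q'; opl q' x' y\<rbrakk> \<Longrightarrow> q = q'"
    and third_point: "\<lbrakk>on p x; on q x\<rbrakk> \<Longrightarrow> \<exists>r. on r x \<and> r \<noteq> p \<and> r \<noteq> q"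
    and plump2: "\<lbrakk>on p x; on p y\<rbrakk> \<Longrightarrow> \<exists>z. opl p x z \<and> opl p y z"
    and close_path: "\<lbrakk>on p x; p \<noteq> q; opl q x y; on r y; q \<noteq> r; opl r y z\<rbrakk> \<Longrightarrow>
      \<exists>s w. s \<noteq> p \<and> s \<noteq> r \<and> opl s z w \<and> opl p w x"
    and connected_points: "\<lbrakk>on p x; on q y\<rbrakk> \<Longrightarrow> (\<lambda>a b. \<exists>z. on a z \<and> on b z)\<^sup>*\<^sup>* p q"
begin

definition col :: "'p \<Rightarrow> 'p \<Rightarrow> bool" where
  "col a b \<longleftrightarrow> (\<exists>x. on a x \<and> on b x)"

text \<open>A root between points. At its two lines opposition is just distinctness of points, hence
  \<open>a \<noteq> b\<close> and \<open>c \<noteq> b\<close>.\<close>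

definition far :: "'p \<Rightarrow> 'p \<Rightarrow> bool" where
  "far a c \<longleftrightarrow> (\<exists>x b y. on a x \<and> a \<noteq> b \<and> opl b x y \<and> on c y \<and> c \<noteq> b)"

text \<open>The ends of a weed, with distance 4 and non-straightness expressed by \<open>col\<close>
  and \<open>far\<close>; see \<open>weed_iff\<close>.\<close>

definition sim :: "'p \<Rightarrow> 'p \<Rightarrow> bool" where
  "sim a c \<longleftrightarrow> \<not> col a c \<and> \<not> far a c \<and> (\<exists>b. col a b \<and> col b c)"

definition eqv :: "'p \<Rightarrow> 'p \<Rightarrow> bool" where
  "eqv a b \<longleftrightarrow> (\<forall>r. far a r \<longleftrightarrow> far b r)"

definition leq :: "'l \<Rightarrow> 'l \<Rightarrow> bool" where
  "leq x y \<longleftrightarrow> (\<forall>g. (\<forall>q. on q x \<longrightarrow> \<not> far g q) \<longleftrightarrow> (\<forall>q. on q y \<longrightarrow> \<not> far g q))"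

text \<open>A root between lines: the path \<open>x p w q z\<close>, where opposition at the middle
  line \<open>w\<close> amounts to \<open>p \<noteq> q\<close>.\<close>

definition lfar :: "'l \<Rightarrow> 'l \<Rightarrow> bool" where
  "lfar x z \<longleftrightarrow> (\<exists>p w q. opl p x w \<and> p \<noteq> q \<and> opl q w z)"

section \<open>Opposite points and projection to a line\<close>

lemma opl_on2: "opl p x y \<Longrightarrow> on p y"
  using opl_on opl_sym by blast

lemma col_sym: "col a b \<Longrightarrow> col b a"
  by (auto simp: col_def)

lemma far_sym: "far a b \<Longrightarrow> far b a"
  unfolding far_def using opl_sym by blast

lemma sim_sym: "sim a c \<Longrightarrow> sim c a"
  unfolding sim_def using col_sym far_sym by blast

lemma farI: "\<lbrakk>opl b x y; on a x; a \<noteq> b; on c y; c \<noteq> b\<rbrakk> \<Longrightarrow> far a c"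
  unfolding far_def by blast

text \<open>Let \<open>u\<close> be opposite both the first line of the root and a supposed joining
  line \<open>z\<close>. Closing the reversed root prolonged by \<open>u\<close> gives a straight
  path from \<open>c\<close> to \<open>u\<close> besides the one through \<open>z\<close> and
  \<open>a\<close>; \<open>unique_proj\<close> forces \<open>d = a\<close>.\<close>

lemma far_not_col:
  assumes "far a c" shows "\<not> col a c"
proof
  assume "col a c"
  then obtain z where z: "on a z" "on c z" by (auto simp: col_def)
  obtain x b y where p: "on a x" "a \<noteq> b" "opl b x y" "on c y" "c \<noteq> b"
    using assms by (auto simp: far_def)
  have ac: "a \<noteq> c"
    using p unique_line opl_on opl_on2 opl_irrefl by metis
  obtain u where u: "opl a x u" "opl a z u" using plump2 p(1) z(1) by blast
  obtain d w where dw: "d \<noteq> c" "d \<noteq> a" "opl d u w" "opl c w y"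
    using close_path[of c y b x a u] p u opl_sym by metis
  have "d = a"
    using unique_proj[of c w d u z a] dw z ac u opl_sym opl_on by metis
  with dw show False by simp
qed

lemma not_far_self: "on a x \<Longrightarrow> \<not> far a a"
  using far_not_col by (auto simp: col_def)

text \<open>Two exchanges of the first line, through a common opposite \<open>v\<close>, turn the
  given root into one that starts with \<open>u\<close>. Its middle point \<open>d\<close> is
  collinear with \<open>c\<close>, and every other point of \<open>u\<close> starts a root to
  \<open>c\<close>.\<close>

lemma far_line:
  assumes "far a c" "on a u"
  obtains d w where "opl d u w" "on c w" "c \<noteq> d" "d \<noteq> a"
    "\<And>q. \<lbrakk>on q u; q \<noteq> d\<rbrakk> \<Longrightarrow> far q c" "\<And>q. \<lbrakk>on q u; col q c\<rbrakk> \<Longrightarrow> q = d"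
proof -
  \<comment> \<open>One exchange: the reversed root, prolonged by \<open>v\<close>, closes up, and
    the other half of the circuit is a root from \<open>a\<close> to \<open>c\<close> starting with
    \<open>v\<close>.\<close>
  have step: "\<exists>d w. d \<noteq> c \<and> d \<noteq> a \<and> opl d v w \<and> on c w"
    if "opl b x y" "on a x" "a \<noteq> b" "on c y" "c \<noteq> b" "opl a x v" for x b y v
    using close_path[of c y b x a v] that opl_sym opl_on by metis
  obtain x b y where p: "on a x" "a \<noteq> b" "opl b x y" "on c y" "c \<noteq> b"
    using assms by (auto simp: far_def)
  obtain v where v: "opl a x v" "opl a u v" using plump2 p(1) assms(2) by blast
  obtain e k where e: "e \<noteq> c" "e \<noteq> a" "opl e v k" "on c k"
    using step[OF p(3,1,2,4,5) v(1)] by blast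
  obtain d w where d: "d \<noteq> c" "d \<noteq> a" "opl d u w" "on c w"
    using step[of e v k u] e v opl_sym opl_on2 by metis
  have f: "far q c" if "on q u" "q \<noteq> d" for q
    using farI d that by metis
  then have "q = d" if "on q u" "col q c" for q
    using far_not_col that by blast
  with f d that show ?thesis by metis
qed

text \<open>Here \<open>b\<close> must be the projection of \<open>c\<close> to \<open>x\<close>,
  and \<open>y\<close> the only line joining it to \<open>c\<close>. So between opposite points
  every such path is straight, not just one.\<close>

lemma far_straight:
  assumes "far a c" "on a x" "on b x" "on b y" "on c y"
  shows "opl b x y"
proof -
  obtain d w where d: "opl d x w" "on c w" "c \<noteq> d" "\<And>q. \<lbrakk>on q x; col q c\<rbrakk> \<Longrightarrow> q = d"
    using far_line[OF assms(1,2)] by metis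
  have "b = d" using d(4) assms by (auto simp: col_def)
  then have "w = y" using unique_line d assms opl_on2 by metis
  with d \<open>b = d\<close> show ?thesis by simp
qed

text \<open>A weed from \<open>a\<close> to \<open>c\<close> can be rerouted through any line on \<open>a\<close>.\<close>

lemma sim_line:
  assumes "sim a c" "on a u"
  obtains d where "on d u" "col d c"
proof -
  have ac: "\<not> col a c" "\<not> far a c" using assms by (auto simp: sim_def)
  have step: "\<exists>d. on d v \<and> col d c"
    if b: "on a x" "on b x" "col b c" and v: "opl a x v" for x b v
  proof -
    obtain y where y: "on b y" "on c y" using b by (auto simp: col_def)
    \<comment> \<open>A line opposite both \<open>x\<close> and \<open>y\<close> at \<open>b\<close>
      supplies a point \<open>e\<close> opposite both \<open>a\<close> and \<open>c\<close>, so that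
      \<open>far_line\<close> becomes available.\<close>
    obtain z where z: "opl b x z" "opl b y z" using plump2 b y by blast
    obtain e where e: "on e z" "e \<noteq> b" using third_point opl_on2[OF z(1)] by blast
    have ab: "a \<noteq> b" "c \<noteq> b" using ac b y by (auto simp: col_def)
    have fa: "far a e" "far e c" using farI far_sym z b y e ab by metis+
    obtain d w where d: "opl d v w" "on e w" "e \<noteq> d" "d \<noteq> a"
      using far_line[OF fa(1) opl_on2[OF v]] by metis
    obtain d' w' where d': "opl d' w w'" "on c w'" "\<And>q. \<lbrakk>on q w; q \<noteq> d'\<rbrakk> \<Longrightarrow> far q c"
      using far_line[OF fa(2) d(2)] by metis
    show ?thesis
    proof (cases "d = d'")
      case True
      then show ?thesis using d d' opl_on opl_on2 by (metis col_def)
    next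
      case False
      \<comment> \<open>Now \<open>c\<close> is opposite all points of \<open>v\<close> but one. As
        \<open>a\<close> is on \<open>v\<close> and not opposite \<open>c\<close>, it is the
        exception and hence collinear with \<open>c\<close>, which is absurd.\<close>
      then have "far d c" using d' d opl_on2 by metis
      then obtain d2 v2 where d2: "opl d2 v v2" "on c v2" "\<And>q. \<lbrakk>on q v; q \<noteq> d2\<rbrakk> \<Longrightarrow> far q c"
        using far_line[OF _ opl_on[OF d(1)]] by metis
      have "a = d2" using d2 ac opl_on2[OF v] by metis
      then show ?thesis using d2 ac opl_on2 by (metis col_def)
    qed
  qed
  obtain x b where b: "on a x" "on b x" "col b c" using assms by (auto simp: sim_def col_def)
  obtain v where v: "opl a x v" "opl a u v" using plump2 b assms(2) by blast
  obtain e where e: "on e v" "col e c" using step[OF b v(1)] by blast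
  show ?thesis using step[of v e u] e v opl_on2 opl_sym that by metis
qed

text \<open>Induction along a chain of collinear points, with the claim for all lines on
  \<open>r\<close> at once: applied to the line from \<open>r\<close> to the next point
  \<open>s\<close>, it shows that \<open>s\<close> is collinear with, opposite or similar to
  \<open>p\<close>, and each case has its projection.\<close>

lemma projection_exists:
  assumes "on p x" "on r y"
  obtains q where "on q y" "col q p"
proof -
  have "(\<lambda>a b. \<exists>z. on a z \<and> on b z)\<^sup>*\<^sup>* p r" using connected_points assms by blast
  then have "\<forall>y. on r y \<longrightarrow> (\<exists>q. on q y \<and> col q p)"
  proof induction
    case base
    then show ?case by (auto simp: col_def)
  next
    case (step r s)
    then obtain z where z: "on r z" "on s z" by blast
    then obtain q where q: "on q z" "col q p" using step by blast
    show ?case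
    proof (intro allI impI)
      fix y assume y: "on s y"
      consider "col s p" | "far s p" | "sim s p"
        using q z by (auto simp: sim_def col_def)
      then show "\<exists>q. on q y \<and> col q p"
      proof cases
        case 2
        then show ?thesis using far_line[OF _ y] opl_on opl_on2 by (metis col_def)
      qed (use y sim_line in \<open>blast+\<close>)
    qed
  qed
  with assms that show ?thesis by blast
qed

lemma sim_far:
  assumes "sim a c" "far a f"
  shows "far c f"
proof (rule ccontr)
  \<comment> \<open>A counterexample \<open>f\<close> would be collinear with every common neighbour of \<open>a\<close> and \<open>c\<close>; moving \<open>a\<close>
    to a third point \<open>m\<close> of a line on \<open>a\<close> gives another counterexample with incompatible neighbours.\<close>
  have not_col: "\<not> col f c" if prem: "sim a c" "far a f" "\<not> far c f" for a c f
  proof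
    assume "col f c"
    then obtain k where k: "on f k" "on c k" by (auto simp: col_def)
    obtain d w where d: "opl d k w" "on a w" "\<And>q. \<lbrakk>on q k; q \<noteq> d\<rbrakk> \<Longrightarrow> far q a"
      using far_line[OF far_sym[OF prem(2)] k(1)] by metis
    have "c = d" using d k prem far_sym by (auto simp: sim_def)
    then show False using d prem opl_on2 unfolding sim_def col_def by metis
  qed
  have common: "col b f" if prem: "sim a c" "far a f" "\<not> far c f" "col a b" "col b c" for a b c f
  proof -
    obtain x y where xy: "on a x" "on b x" "on b y" "on c y" using prem by (auto simp: col_def)
    obtain g w where g: "opl g x w" "on f w" "\<And>q. \<lbrakk>on q x; q \<noteq> g\<rbrakk> \<Longrightarrow> far q f"
      using far_line[OF prem(2) xy(1)] by metis
    show ?thesis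
    proof (cases "b = g")
      case True
      then show ?thesis using g opl_on2 by (metis col_def)
    next
      case False
      \<comment> \<open>If \<open>b\<close> is opposite \<open>f\<close>, then \<open>c\<close> can
        only be the projection of \<open>f\<close> to \<open>y\<close>, which \<open>not_col\<close>
        excludes.\<close>
      then have "far b f" using g xy by blast
      then obtain d w where d: "opl d y w" "on f w" "\<And>q. \<lbrakk>on q y; q \<noteq> d\<rbrakk> \<Longrightarrow> far q f"
        using far_line[OF _ xy(3)] by metis
      have "c = d" using d xy prem by blast
      then have "col f c" using d opl_on2 by (metis col_def)
      then show ?thesis using not_col prem by blast
    qed
  qed
  assume nf: "\<not> far c f"
  have ac: "\<not> col a c" "\<not> far a c" using assms by (auto simp: sim_def)
  obtain b x where b: "on a x" "on b x" "col b c" using assms by (auto simp: sim_def col_def)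
  \<comment> \<open>As \<open>u\<close> is opposite \<open>x\<close>, the point \<open>b\<close>
    will be opposite every point of \<open>u\<close> except \<open>a\<close>; this is the
    contradiction aimed at.\<close>
  obtain u where u: "opl a x u" using plump2 b by blast
  obtain d where d: "on d u" "col d c" using sim_line assms(1) opl_on2[OF u] by metis
  have bf: "col b f" "col d f"
    using common[OF assms nf] b d opl_on2[OF u] by (auto simp: col_def)
  have da: "d \<noteq> a" "b \<noteq> a" using d b ac by auto
  obtain m where m: "on m u" "m \<noteq> a" "m \<noteq> d" using third_point opl_on2[OF u] d by blast
  have mf: "far m f" using far_line[OF assms(2) opl_on2[OF u]] m d bf by metis
  obtain v where v: "on d v" "on c v" using d by (auto simp: col_def)
  have "\<not> far m c"
  proof
    assume "far m c"
    then have "opl d u v" using far_straight m d v by metis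
    moreover have "c \<noteq> d" using ac d opl_on2[OF u] by (auto simp: col_def)
    ultimately have "far a c" using farI u opl_on2 da v by metis
    then show False using ac by simp
  qed
  moreover have "\<not> col m c"
  proof
    assume "col m c"
    then have "col m f" using common[OF assms nf] m opl_on2[OF u] by (auto simp: col_def)
    then show False using mf far_not_col by blast
  qed
  moreover have "\<not> col f c" using not_col assms nf by blast
  \<comment> \<open>So \<open>common\<close> applies again, with \<open>f\<close>, \<open>c\<close>,
    \<open>m\<close> in the roles of \<open>a\<close>, \<open>c\<close>, \<open>f\<close>, and makes
    \<open>b\<close> collinear with \<open>m\<close>.\<close>
  then have "sim f c" using nf far_sym bf b col_sym unfolding sim_def by blast
  ultimately have "col b m"
    using common[of f c m b] mf far_sym bf b col_sym by blast
  moreover have "far b m" using farI[OF u] b m da by blast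
  ultimately show False using far_not_col by blast
qed

lemma sim_eqv: "sim a c \<Longrightarrow> eqv a c"
  unfolding eqv_def using sim_far sim_sym by blast

section \<open>Equivalent points and the polar space axiom\<close>

lemma eqv_refl [simp]: "eqv a a"
  by (simp add: eqv_def)

lemma eqv_sym: "eqv a b \<Longrightarrow> eqv b a"
  by (simp add: eqv_def)

lemma eqv_trans: "\<lbrakk>eqv a b; eqv b c\<rbrakk> \<Longrightarrow> eqv a c"
  by (simp add: eqv_def)

lemma eqv_far: "\<lbrakk>eqv a a'; eqv b b'\<rbrakk> \<Longrightarrow> far a b \<longleftrightarrow> far a' b'"
  unfolding eqv_def using far_sym by blast

lemma col_or_sim:
  assumes "on p x" "on q y" "\<not> far p q"
  shows "col p q \<or> sim p q"
  using projection_exists[OF assms(1,2)] assms(2,3) col_sym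
  unfolding sim_def by (metis col_def)

text \<open>If some point of the line were opposite \<open>p\<close>, then \<open>far_line\<close>
  would leave only one point of it that is not.\<close>

lemma one_or_all:
  assumes "on a x" "on b x" "a \<noteq> b" "\<not> far p a" "\<not> far p b" "on c x"
  shows "\<not> far p c"
  using assms far_line[of c p x] far_sym by metis

text \<open>Any line opposite \<open>x\<close> at \<open>p\<close> carries such a point
  \<open>r\<close>. This is the nondegeneracy of the polar space: opposite sets tell apart the
  points of one line.\<close>

lemma separate:
  assumes "on p x"
  obtains z r where "opl p x z" "on r z" "r \<noteq> p" "col p r"
    "\<And>q. \<lbrakk>on q x; q \<noteq> p\<rbrakk> \<Longrightarrow> far q r"
  using assms plump2[of p x x] third_point farI opl_on2 by (metis col_def)

lemma eqv_on_line_eq: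
  assumes "on p x" "on q x" "eqv p q" shows "p = q"
  using separate[OF assms(1)] assms far_not_col unfolding eqv_def by metis

lemma eqv_sim:
  assumes "on a x" "on c y" "eqv a c" "a \<noteq> c" shows "sim a c"
proof -
  have "\<not> col a c" using eqv_on_line_eq assms by (auto simp: col_def)
  moreover have "\<not> far a c" using assms not_far_self by (auto simp: eqv_def)
  ultimately show ?thesis using col_or_sim assms by blast
qed

lemma col_not_far: "col a b \<Longrightarrow> \<not> far a b"
  using far_not_col by blast

text \<open>
  The hyperplane argument of polar space theory: inside the perp of \<open>m\<close>, the perp of \<open>a\<close> together with
  the single point \<open>f\<close> generates everything, so a point \<open>s\<close> perpendicular to these is
  perpendicular to the whole perp of \<open>m\<close>.
\<close>

lemma hyperplane:
  assumes "on a x" "on m x" "a \<noteq> m" and s: "on s y" and f: "on f z"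
    and W: "\<And>g. \<lbrakk>\<not> far g a; \<not> far g m\<rbrakk> \<Longrightarrow> \<not> far g s"
    and fms: "\<not> far f m" "\<not> far f s" "far f a" and ms: "\<not> far m s"
  shows "eqv m s"
proof (rule ccontr)
  assume ne: "\<not> eqv m s"
  then have "col m s" using col_or_sim assms(2) s ms sim_eqv by blast
  then obtain k where k: "on m k" "on s k" by (auto simp: col_def)
  have "m \<noteq> s" using ne by auto
  \<comment> \<open>A witness that \<open>s\<close> misses part of the perp of \<open>m\<close>; the
    rest shows that \<open>s\<close> is perpendicular to it after all.\<close>
  obtain h w where h: "on h w" "col m h" "far s h"
    using separate[OF k(1)] k \<open>m \<noteq> s\<close> by metis
  have "col a m" using assms by (auto simp: col_def)
  then have as: "\<not> far a s" using W assms(1) not_far_self col_not_far by blast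
  have "col f s" using col_or_sim[OF f s fms(2)] sim_far fms as far_sym by blast
  then obtain \<sigma> where \<sigma>: "on f \<sigma>" "on s \<sigma>" by (auto simp: col_def)
  have "f \<noteq> s" using fms as far_sym by auto
  \<comment> \<open>The line \<tau> through \<open>t\<close> and \<open>h\<close> lies in the perp
    of \<open>m\<close> and meets the perp of \<open>a\<close> in some \<open>g\<close>. By
    \<open>W\<close>, \<open>s\<close> is perpendicular to \<open>g\<close>; being also
    perpendicular to \<open>t\<close>, it is perpendicular to \<open>h\<close>.\<close>
  obtain t where t: "on t \<sigma>" "col t h" using projection_exists h \<sigma> by metis
  have so: "\<not> col s h" using h far_not_col by blast
  then have "t \<noteq> s" using t by auto
  then have ta: "far t a" using one_or_all[of s \<sigma> t a f] as t \<sigma> fms far_sym by blast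
  have tm: "\<not> far m t" using one_or_all[of f \<sigma> s m t] \<sigma> \<open>f \<noteq> s\<close> fms far_sym ms t by blast
  obtain \<tau> where \<tau>: "on t \<tau>" "on h \<tau>" using t by (auto simp: col_def)
  have "t \<noteq> h" using t \<sigma> so by (auto simp: col_def)
  obtain g where g: "on g \<tau>" "col g a" using projection_exists assms(1) \<tau> by metis
  have "\<not> far g m"
    using one_or_all[of t \<tau> h m g] \<tau> \<open>t \<noteq> h\<close> tm h col_not_far g far_sym by blast
  then have "\<not> far g s" using W g col_not_far by blast
  moreover have "g \<noteq> t" using ta g far_not_col by auto
  moreover have "\<not> far t s" using t \<sigma> col_not_far by (auto simp: col_def)
  ultimately have "\<not> far s h" using one_or_all[of g \<tau> t s h] g \<tau> far_sym by blast
  then show False using h by simp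
qed

section \<open>Equivalence and opposition of lines\<close>

lemma leq_refl [simp]: "leq x x"
  by (simp add: leq_def)

lemma leq_sym: "leq x y \<Longrightarrow> leq y x"
  by (simp add: leq_def)

lemma leq_trans: "\<lbrakk>leq x y; leq y z\<rbrakk> \<Longrightarrow> leq x z"
  by (simp add: leq_def)

text \<open>Take \<open>f\<close> collinear with \<open>m\<close> and opposite another point
  \<open>a\<close> of \<open>x\<close>; its projection to \<open>y\<close> is the required
  \<open>s\<close>. Since the perp of \<open>x\<close> is contained in that of \<open>s\<close>,
  \<open>hyperplane\<close> applies. The premise on \<open>r\<close> ensures that \<open>y\<close>
  carries a point from which to project.\<close>

lemma leq_point:
  assumes "leq x y" "on m x" "on r y"
  obtains s where "on s y" "eqv m s"
proof -
  obtain a where a: "on a x" "a \<noteq> m" using third_point assms(2) by blast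
  obtain z f where f: "on f z" "col m f" "far a f"
    using separate[OF assms(2)] a by metis
  obtain s where s: "on s y" "col s f" using projection_exists f assms by metis
  have lq: "(\<forall>q. on q x \<longrightarrow> \<not> far g q) \<longleftrightarrow> (\<forall>q. on q y \<longrightarrow> \<not> far g q)" for g
    using assms(1) by (simp add: leq_def)
  have "\<forall>q. on q x \<longrightarrow> \<not> far m q" using assms(2) col_not_far by (auto simp: col_def)
  then have ms: "\<not> far m s" using lq s by blast
  have W: "\<not> far g s" if "\<not> far g a" "\<not> far g m" for g
    using one_or_all[of a x m g] a assms(2) that lq s by blast
  have "eqv m s"
    using hyperplane[OF a(1) assms(2) a(2) s(1) f(1) W] f s ms far_sym col_sym col_not_far by blast
  with s that show ?thesis by blast
qed

text \<open>By \<open>one_or_all\<close>, perpendicularity to a line is decided on two of its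
  points, and there it depends only on their classes.\<close>

lemma leqI:
  assumes "on a x" "on b x" "a \<noteq> b" "on a' y" "on b' y" "eqv a a'" "eqv b b'"
  shows "leq x y"
proof -
  have "a' \<noteq> b'" using assms eqv_on_line_eq eqv_sym eqv_trans by metis
  moreover have "far g a \<longleftrightarrow> far g a'" "far g b \<longleftrightarrow> far g b'" for g
    using assms eqv_far eqv_refl by blast+
  ultimately show ?thesis
    unfolding leq_def using one_or_all assms by metis
qed

text \<open>A second point \<open>d\<close> of \<open>x\<close> is perpendicular to
  \<open>a\<close>, hence to \<open>b\<close>, and not equivalent to \<open>b\<close>. So it is
  collinear with \<open>b\<close>, and the joining line agrees with \<open>x\<close> in two
  classes.\<close>

lemma leq_line_through:
  assumes "on a x" "on b y" "eqv a b"
  obtains x' where "on b x'" "leq x x'"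
proof -
  obtain d where d: "on d x" "d \<noteq> a" using third_point assms by blast
  have "\<not> far d a" using d assms col_not_far by (auto simp: col_def)
  then have "\<not> far d b" using assms eqv_far eqv_refl by blast
  moreover have "\<not> eqv d b" using d assms eqv_on_line_eq eqv_trans eqv_sym by blast
  ultimately have "col d b" using col_or_sim d assms sim_eqv by blast
  then obtain x' where "on d x'" "on b x'" by (auto simp: col_def)
  then show ?thesis using that leqI[of a x d b x' d] d assms by auto
qed

text \<open>Further points of \<open>x\<close> and \<open>y\<close> are opposite, hence so are
  equivalent points on \<open>u\<close> and \<open>v\<close>, and \<open>far_straight\<close> reads
  off opposition at \<open>b\<close>. This makes opposition in the quotient independent of
  representatives.\<close>

lemma opl_transfer:
  assumes "opl a x y" "on b u" "on b v" "leq x u" "leq y v" "eqv a b"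
  shows "opl b u v"
proof -
  obtain p where p: "on p x" "p \<noteq> a" using third_point opl_on assms by metis
  obtain q where q: "on q y" "q \<noteq> a" using third_point opl_on2 assms by metis
  obtain p' where p': "on p' u" "eqv p p'" using leq_point assms p by metis
  obtain q' where q': "on q' v" "eqv q q'" using leq_point assms q by metis
  have "far p q" using farI assms p q by blast
  then have "far p' q'" using eqv_far p' q' by blast
  then show ?thesis using far_straight p' q' assms by blast
qed

text \<open>A root \<open>q x d w h\<close> between points, shifted by one step, is a root
  \<open>x d w h z\<close> between lines, and conversely. Consequently the opposite set of a line
  determines its perp, as \<open>lfar_leq\<close> records.\<close>

lemma not_perp_line_iff:
  assumes "on h y"
  shows "(\<exists>q. on q x \<and> far h q) \<longleftrightarrow> (\<exists>z. on h z \<and> lfar x z)"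
proof
  assume "\<exists>q. on q x \<and> far h q"
  then obtain q where q: "on q x" "far q h" using far_sym by blast
  then obtain d w where d: "opl d x w" "on h w" "h \<noteq> d" using far_line by metis
  then obtain z where "opl h w z" using plump2 by blast
  then show "\<exists>z. on h z \<and> lfar x z" using d opl_on2 unfolding lfar_def by metis
next
  assume "\<exists>z. on h z \<and> lfar x z"
  then obtain z p w q where z: "on h z" "opl p x w" "p \<noteq> q" "opl q w z"
    by (auto simp: lfar_def)
  show "\<exists>q. on q x \<and> far h q"
  \<comment> \<open>The shift back starts at a further point of \<open>x\<close> if \<open>h\<close>
    is the point \<open>q\<close> of the root, and at \<open>p\<close> otherwise.\<close>
  proof (cases "h = q")
    case True
    obtain r where "on r x" "r \<noteq> p" using third_point opl_on z by metis
    then show ?thesis using farI z True opl_on far_sym by metis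
  next
    case False
    then have "far p h" using farI[OF z(4)] z opl_on2 by blast
    then show ?thesis using z opl_on far_sym by blast
  qed
qed

lemma lfar_leq:
  assumes "\<And>z. lfar x z \<longleftrightarrow> lfar y z" shows "leq x y"
proof -
  have "(\<exists>q. on q x \<and> far g q) \<longleftrightarrow> (\<exists>q. on q y \<and> far g q)" for g
  proof (cases "\<exists>w. on g w")
    case True
    then show ?thesis using not_perp_line_iff assms by metis
  next
    case False
    then show ?thesis by (auto simp: far_def)
  qed
  then show ?thesis by (auto simp: leq_def)
qed

end

section \<open>Paths and circuits as lists\<close>

text \<open>A recursive form of \<open>is_path\<close> without its length, so that simplification
  unfolds explicit lists.\<close>

fun path_steps :: "'v set \<Rightarrow> ('v \<Rightarrow> 'v \<Rightarrow> bool) \<Rightarrow> 'v list \<Rightarrow> bool" where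
  "path_steps V adj [] \<longleftrightarrow> True"
| "path_steps V adj [x] \<longleftrightarrow> x \<in> V"
| "path_steps V adj [x, y] \<longleftrightarrow> x \<in> V \<and> y \<in> V \<and> adj x y"
| "path_steps V adj (x # y # z # zs) \<longleftrightarrow> x \<in> V \<and> adj x y \<and> x \<noteq> z \<and> path_steps V adj (y # z # zs)"

lemma path_steps_iff:
  "path_steps V adj xs \<longleftrightarrow> set xs \<subseteq> V \<and> (\<forall>i. Suc i < length xs \<longrightarrow> adj (xs ! i) (xs ! Suc i)) \<and>
     (\<forall>i. Suc (Suc i) < length xs \<longrightarrow> xs ! i \<noteq> xs ! Suc (Suc i))"
proof (induction V adj xs rule: path_steps.induct)
  case (4 V adj x y z zs)
  have shift: "(\<forall>i. P i) \<longleftrightarrow> P 0 \<and> (\<forall>i. P (Suc i))" for P :: "nat \<Rightarrow> bool"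
    by (metis not0_implies_Suc)
  show ?case
    unfolding path_steps.simps 4
    by (subst (3 4) shift) auto
qed auto

lemma is_path_iff: "is_path V adj s xs \<longleftrightarrow> length xs = Suc s \<and> path_steps V adj xs"
proof -
  have "(\<forall>i. 2 \<le> i \<and> i \<le> s \<longrightarrow> xs ! (i - 2) \<noteq> xs ! i) \<longleftrightarrow>
        (\<forall>i. Suc (Suc i) < Suc s \<longrightarrow> xs ! i \<noteq> xs ! Suc (Suc i))"
    by (metis (no_types, lifting) Suc_1 Suc_le_mono add_2_eq_Suc diff_Suc_Suc diff_zero le_add1 less_Suc_eq_le ordered_cancel_comm_monoid_diff_class.add_diff_inverse zero_le numeral_2_eq_2)
  moreover have "(\<forall>i<s. adj (xs ! i) (xs ! (i + 1))) \<longleftrightarrow>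
      (\<forall>i. Suc i < Suc s \<longrightarrow> adj (xs ! i) (xs ! Suc i))"
    by simp
  ultimately show ?thesis
    unfolding is_path_def path_steps_iff by auto
qed

lemma straight_simps [simp]:
  "straight opp [x]" "straight opp [x, y]"
  "straight opp (x # y # z # zs) \<longleftrightarrow> opp y x z \<and> straight opp (y # z # zs)"
proof -
  have shift: "(\<forall>i\<ge>1. P i) \<longleftrightarrow> P 1 \<and> (\<forall>i\<ge>1. P (Suc i))" for P :: "nat \<Rightarrow> bool"
    by (metis One_nat_def Suc_le_D Suc_le_mono le_0_eq le_SucE nle_le zero_le)
  have "(\<forall>i\<ge>1. i + 1 < length (x # y # z # zs) \<longrightarrow>
           opp ((x # y # z # zs) ! i) ((x # y # z # zs) ! (i - 1)) ((x # y # z # zs) ! (i + 1))) \<longleftrightarrow>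
        opp y x z \<and> (\<forall>i\<ge>1. i + 1 < length (y # z # zs) \<longrightarrow>
           opp ((y # z # zs) ! i) ((y # z # zs) ! (i - 1)) ((y # z # zs) ! (i + 1)))"
    by (subst shift) (auto simp: nth_Cons')
  then show "straight opp (x # y # z # zs) \<longleftrightarrow> opp y x z \<and> straight opp (y # z # zs)"
    unfolding straight_def by blast
qed (auto simp: straight_def)

lemma straightD: "\<lbrakk>straight opp xs; Suc (Suc i) < length xs\<rbrakk> \<Longrightarrow>
    opp (xs ! Suc i) (xs ! i) (xs ! Suc (Suc i))"
  unfolding straight_def by (drule spec[of _ "Suc i"]) auto

lemma straightI: "(\<And>i. Suc (Suc i) < length xs \<Longrightarrow> opp (xs ! Suc i) (xs ! i) (xs ! Suc (Suc i)))
    \<Longrightarrow> straight opp xs"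
  unfolding straight_def by (metis Suc_eq_plus1 Suc_pred' diff_Suc_1 less_eq_Suc_le One_nat_def)

lemma walk_simps [simp]:
  "\<not> walk adj []" "walk adj [x]"
  "walk adj (x # y # zs) \<longleftrightarrow> adj x y \<and> walk adj (y # zs)"
proof -
  have shift: "(\<forall>i. P i) \<longleftrightarrow> P 0 \<and> (\<forall>i. P (Suc i))" for P :: "nat \<Rightarrow> bool"
    by (metis not0_implies_Suc)
  show "walk adj (x # y # zs) \<longleftrightarrow> adj x y \<and> walk adj (y # zs)"
    unfolding walk_def by (subst shift) auto
qed (auto simp: walk_def)

text \<open>A closed 8-path is indexed below by the integers modulo 8, so that rotating and reversing it
  is affine reindexing.\<close>

locale octagon =
  fixes cs :: "'v list"
  assumes length_cs: "length cs = 9" and closed: "cs ! 8 = cs ! 0"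
    and distinct: "\<And>i j. \<lbrakk>i < j; j < 8\<rbrakk> \<Longrightarrow> cs ! i \<noteq> cs ! j"
begin

definition c :: "int \<Rightarrow> 'v" where "c k = cs ! nat (k mod 8)"

lemma c_eq_iff: "c i = c j \<longleftrightarrow> i mod 8 = j mod 8"
proof
  assume "c i = c j"
  moreover have "nat (i mod 8) < 8" "nat (j mod 8) < 8" by (simp_all add: nat_less_iff)
  ultimately have "nat (i mod 8) = nat (j mod 8)"
    unfolding c_def using distinct by (metis linorder_neqE_nat)
  then show "i mod 8 = j mod 8" by (metis nat_eq_iff2 Euclidean_Rings.pos_mod_sign zero_less_numeral nat_0_le)
qed (simp add: c_def)

lemma c_nth: "i < 9 \<Longrightarrow> cs ! i = c (int i)"
proof (cases "i = 8")
  case True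
  then show ?thesis using closed by (simp add: c_def)
next
  case False
  assume "i < 9"
  with False have "int i mod 8 = int i" by simp
  then show ?thesis by (simp add: c_def)
qed

lemma c_in: "c k \<in> set cs"
proof -
  have "nat (k mod 8) < 9" by (simp add: nat_less_iff order_less_trans[of _ 8])
  then show ?thesis unfolding c_def by (simp add: length_cs)
qed

lemma in_cs: "v \<in> set cs \<longleftrightarrow> (\<exists>k. v = c k)"
  using c_in c_nth by (metis in_set_conv_nth length_cs)

lemma edge_succ: "circuit_edge cs (c k) (c (k + 1))"
proof -
  let ?i = "nat (k mod 8)"
  have i: "?i < 8" by (simp add: nat_less_iff)
  have "c k = cs ! ?i" by (simp add: c_def)
  moreover have "c (k + 1) = cs ! (?i + 1)"
    using c_nth[of "?i + 1"] i by (simp add: c_eq_iff mod_add_right_eq add.commute[of k])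
  ultimately show ?thesis unfolding circuit_edge_def using i length_cs by force
qed

text \<open>Distinctness is essential: a repeated vertex could have further neighbours in the
  circuit.\<close>

lemma edge_iff: "circuit_edge cs (c k) v \<longleftrightarrow> v = c (k + 1) \<or> v = c (k - 1)"
proof
  assume "circuit_edge cs (c k) v"
  then obtain i where "i + 1 < 9"
    "c k = cs ! i \<and> v = cs ! (i + 1) \<or> v = cs ! i \<and> c k = cs ! (i + 1)"
    unfolding circuit_edge_def length_cs by blast
  then consider "c k = c (int i)" "v = c (int i + 1)" | "v = c (int i)" "c k = c (int i + 1)"
    using c_nth[of i] c_nth[of "i + 1"] by (auto simp: add.commute)
  then show "v = c (k + 1) \<or> v = c (k - 1)"
  proof cases
    case 1
    then show ?thesis unfolding c_eq_iff by (metis c_eq_iff mod_add_left_eq)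
  next
    case 2
    then show ?thesis unfolding c_eq_iff by (metis add_diff_cancel_right' c_eq_iff mod_diff_left_eq)
  qed
next
  have "circuit_edge cs (c (k - 1)) (c k)" using edge_succ[of "k - 1"] by simp
  moreover assume "v = c (k + 1) \<or> v = c (k - 1)"
  ultimately show "circuit_edge cs (c k) v"
    using edge_succ[of k] unfolding circuit_edge_def by blast
qed

lemma c_skip: "c (k - 1) \<noteq> c (k + 1)"
  unfolding c_eq_iff by presburger

text \<open>A path in the octagon passes each inner vertex from one neighbour to the other. Both
  orders are listed because \<open>opp\<close> need not be symmetric here.\<close>

lemma straight_circuit_iff:
  "straight_circuit opp cs \<longleftrightarrow>
     (\<forall>k. opp (c k) (c (k - 1)) (c (k + 1)) \<and> opp (c k) (c (k + 1)) (c (k - 1)))"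
proof (intro iffI allI)
  fix k assume s: "straight_circuit opp cs"
  have e: "circuit_edge cs (c (k - 1)) (c k)" "circuit_edge cs (c k) (c (k - 1))"
      "circuit_edge cs (c (k + 1)) (c k)" "circuit_edge cs (c k) (c (k + 1))"
    using edge_iff[of "k - 1" "c k"] edge_iff[of k] edge_iff[of "k + 1" "c k"] by auto
  have "path_in_circuit cs 2 [c (k - 1), c k, c (k + 1)]"
    "path_in_circuit cs 2 [c (k + 1), c k, c (k - 1)]"
    unfolding path_in_circuit_def is_path_iff using e c_in c_skip[of k] c_skip[of k, symmetric] by auto
  then show "opp (c k) (c (k - 1)) (c (k + 1)) \<and> opp (c k) (c (k + 1)) (c (k - 1))"
    using s unfolding straight_circuit_def by (metis straight_simps(3))
next
  assume opp: "\<forall>k. opp (c k) (c (k - 1)) (c (k + 1)) \<and> opp (c k) (c (k + 1)) (c (k - 1))"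
  show "straight_circuit opp cs"
    unfolding straight_circuit_def
  proof (intro allI impI straightI)
    fix m ys i assume "path_in_circuit cs m ys" and i: "Suc (Suc i) < length ys"
    then have ys: "path_steps (set cs) (circuit_edge cs) ys"
      by (simp add: path_in_circuit_def is_path_iff)
    have "ys ! Suc i \<in> set cs" using ys i unfolding path_steps_iff by (meson Suc_lessD nth_mem subsetD)
    then obtain k where k: "ys ! Suc i = c k" using in_cs by blast
    have "circuit_edge cs (ys ! i) (ys ! Suc i)" "circuit_edge cs (ys ! Suc i) (ys ! Suc (Suc i))"
      "ys ! i \<noteq> ys ! Suc (Suc i)"
      using ys i unfolding path_steps_iff by auto
    then have "ys ! i = c (k + 1) \<or> ys ! i = c (k - 1)"
      "ys ! Suc (Suc i) = c (k + 1) \<or> ys ! Suc (Suc i) = c (k - 1)" "ys ! i \<noteq> ys ! Suc (Suc i)"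
      using k edge_iff unfolding circuit_edge_def by metis+
    then show "opp (ys ! Suc i) (ys ! i) (ys ! Suc (Suc i))" using opp k by metis
  qed
qed

lemma straight_circuitI:
  assumes "\<And>i. i < 8 \<Longrightarrow> opp (cs ! i) (cs ! ((i + 7) mod 8)) (cs ! ((i + 1) mod 8))"
    and "\<And>i. i < 8 \<Longrightarrow> opp (cs ! i) (cs ! ((i + 1) mod 8)) (cs ! ((i + 7) mod 8))"
  shows "straight_circuit opp cs"
  unfolding straight_circuit_iff
proof
  fix k
  define i where "i = nat (k mod 8)"
  have i: "int i = k mod 8" "i < 8" by (simp_all add: i_def nat_less_iff)
  have "cs ! ((i + 7) mod 8) = c (int ((i + 7) mod 8))" "cs ! ((i + 1) mod 8) = c (int ((i + 1) mod 8))"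
    by (rule c_nth, simp add: less_trans[of _ 8])+
  moreover have "c (int ((i + 7) mod 8)) = c (k - 1)" "c (int ((i + 1) mod 8)) = c (k + 1)"
    unfolding c_eq_iff by (simp_all add: zmod_int i(1) mod_simps add.commute[of 1]) (simp add: mod_eq_dvd_iff)
  moreover have "cs ! i = c k" by (simp add: c_def i_def)
  ultimately show "opp (c k) (c (k - 1)) (c (k + 1)) \<and> opp (c k) (c (k + 1)) (c (k - 1))"
    using assms[OF i(2)] by simp
qed

text \<open>There are only two edges at each vertex and turning back is forbidden, so the path keeps
  its first direction \<open>e\<close>.\<close>

lemma path_param:
  assumes "path_steps (set cs) (circuit_edge cs) ys" "2 \<le> length ys"
  obtains k e where "e = 1 \<or> e = -1" "\<And>i. i < length ys \<Longrightarrow> ys ! i = c (k + e * int i)"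
proof -
  have edge: "circuit_edge cs (ys ! i) (ys ! Suc i)" if "Suc i < length ys" for i
    using assms(1) that by (auto simp: path_steps_iff)
  have skip: "ys ! i \<noteq> ys ! Suc (Suc i)" if "Suc (Suc i) < length ys" for i
    using assms(1) that by (auto simp: path_steps_iff)
  have "ys ! 0 \<in> set cs" using assms nth_mem[of 0 ys] unfolding path_steps_iff by (meson gr0I not_numeral_le_zero order_less_le_trans subsetD zero_less_numeral)
  then obtain k where k: "ys ! 0 = c k" using in_cs by blast
  have "ys ! 1 = c (k + 1) \<or> ys ! 1 = c (k - 1)"
    using edge[of 0] assms(2) k edge_iff by simp
  then obtain e :: int where e: "e = 1 \<or> e = -1" "ys ! 1 = c (k + e)" by (metis diff_conv_add_uminus)
  have "(i < length ys \<longrightarrow> ys ! i = c (k + e * int i)) \<and>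
      (Suc i < length ys \<longrightarrow> ys ! Suc i = c (k + e * int (Suc i)))" for i
  proof (induction i)
    case 0
    then show ?case using k e by simp
  next
    case (Suc i)
    show ?case
    proof (intro conjI impI)
      assume l: "Suc (Suc i) < length ys"
      have y: "ys ! Suc i = c (k + e * int (Suc i))" "ys ! i = c (k + e * int i)"
        using Suc l by auto
      have "ys ! Suc (Suc i) = c (k + e * int (Suc i) + 1) \<or> ys ! Suc (Suc i) = c (k + e * int (Suc i) - 1)"
        using edge[OF l] y edge_iff by simp
      moreover have "ys ! Suc (Suc i) \<noteq> c (k + e * int i)" using skip[OF l] y by simp
      ultimately show "ys ! Suc (Suc i) = c (k + e * int (Suc (Suc i)))"
        using e(1) by (auto simp: algebra_simps)
    qed (use Suc in blast)
  qed
  then show ?thesis using that e(1) by blast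
qed

text \<open>Running in direction \<open>e\<close>, positions 8 and 9 wrap around to
  \<open>v0\<close> and \<open>v1\<close>; the missing vertices sit at positions 6 and 7.\<close>

lemma complete_path:
  assumes s: "straight_circuit opp cs" and p: "path_in_circuit cs 5 [v0, v1, v2, v3, v4, v5]"
  obtains v6 v7 where "v6 \<noteq> v0" "v6 \<noteq> v4" "v7 \<noteq> v1" "v7 \<noteq> v5"
    "opp v5 v4 v6" "opp v6 v5 v7" "opp v7 v6 v0" "opp v0 v7 v1"
proof -
  let ?ys = "[v0, v1, v2, v3, v4, v5]"
  obtain k e where e: "e = 1 \<or> e = -1" and v: "\<And>i. i < length ?ys \<Longrightarrow> ?ys ! i = c (k + e * int i)"
    by (rule path_param[of ?ys]) (use p in \<open>simp_all add: path_in_circuit_def is_path_iff\<close>)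
  have "v0 = c k" "v1 = c (k + e)" "v4 = c (k + e * 4)" "v5 = c (k + e * 5)"
    using v[of 0] v[of 1] v[of 4] v[of 5] by simp_all
  moreover have "c k = c (k + e * 8)" "c (k + e) = c (k + e * 9)"
    unfolding c_eq_iff using e by (auto simp: mod_eq_dvd_iff)
  moreover have "opp (c j) (c (j - e)) (c (j + e))" for j
    using s e unfolding straight_circuit_iff by auto
  from this[of "k + e * 5"] this[of "k + e * 6"] this[of "k + e * 7"] this[of "k + e * 8"]
  have "opp (c (k + e * 5)) (c (k + e * 4)) (c (k + e * 6))"
    "opp (c (k + e * 6)) (c (k + e * 5)) (c (k + e * 7))"
    "opp (c (k + e * 7)) (c (k + e * 6)) (c (k + e * 8))"
    "opp (c (k + e * 8)) (c (k + e * 7)) (c (k + e * 9))"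
    using e by (auto simp: algebra_simps)
  moreover have "c (k + e * 6) \<noteq> c k" "c (k + e * 6) \<noteq> c (k + e * 4)"
     "c (k + e * 7) \<noteq> c (k + e)" "c (k + e * 7) \<noteq> c (k + e * 5)"
    unfolding c_eq_iff mod_eq_dvd_iff using e by auto
  ultimately show ?thesis using that[of "c (k + e * 6)" "c (k + e * 7)"] by simp
qed

end

text \<open>Equal vertices have even distance along the arc. Distance 2 is backtracking, distance 4
  gives a straight 3-path with adjacent ends, and distance 6 gives two straight 3-paths with the
  same ends.\<close>

lemma straight_arc_distinct:
  fixes c :: "nat \<Rightarrow> 'v"
  assumes adj_sym: "\<And>u v. adj u v \<Longrightarrow> adj v u"
    and parity: "\<And>u v. adj u v \<Longrightarrow> u \<in> P \<longleftrightarrow> v \<notin> P"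
    and no3: "\<And>u v w z. \<lbrakk>adj u v; adj v w; adj w z; u \<noteq> w; v \<noteq> z; opp v u w; opp w v z\<rbrakk> \<Longrightarrow> \<not> adj u z"
    and uniq3: "\<And>u v w z v' w'. \<lbrakk>adj u v; adj v w; adj w z; u \<noteq> w; v \<noteq> z; opp v u w; opp w v z;
       adj u v'; adj v' w'; adj w' z; u \<noteq> w'; v' \<noteq> z; opp v' u w'; opp w' v' z\<rbrakk> \<Longrightarrow> w = w'"
    and adj: "\<And>i. i < 7 \<Longrightarrow> adj (c i) (c (Suc i))"
    and skip: "\<And>i. i < 6 \<Longrightarrow> c i \<noteq> c (Suc (Suc i))"
    and opp: "\<And>i. i < 6 \<Longrightarrow> opp (c (Suc i)) (c i) (c (Suc (Suc i)))"
      "\<And>i. i < 6 \<Longrightarrow> opp (c (Suc i)) (c (Suc (Suc i))) (c i)"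
    and "i < j" "j < 8"
  shows "c i \<noteq> c j"
proof -
  have par: "c k \<in> P \<longleftrightarrow> (even k \<longleftrightarrow> c 0 \<in> P)" if "k < 8" for k
    using that
  proof (induction k)
    case (Suc k)
    then show ?case using parity[OF adj[of k]] by auto
  qed simp
  have four: "c k \<noteq> c (k + 4)" if "k + 4 < 8" for k
  proof
    assume "c k = c (k + 4)"
    then have "adj (c k) (c (k + 3))" using adj_sym[OF adj[of "k + 3"]] that by (simp add: eval_nat_numeral)
    then show False
      using no3[of "c k" "c (k+1)" "c (k+2)" "c (k+3)"] adj[of k] adj[of "k+1"] adj[of "k+2"]
        skip[of k] skip[of "k+1"] opp(1)[of k] opp(1)[of "k+1"] that
      by (simp add: eval_nat_numeral)
  qed
  have six: "c k \<noteq> c (k + 6)" if "k + 6 < 8" for k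
  proof
    assume "c k = c (k + 6)"
    then have "c (k + 2) = c (k + 4)"
      using uniq3[of "c k" "c (k+1)" "c (k+2)" "c (k+3)" "c (k+5)" "c (k+4)"]
        adj[of k] adj[of "k+1"] adj[of "k+2"] adj_sym[OF adj[of "k+3"]] adj_sym[OF adj[of "k+4"]]
        adj_sym[OF adj[of "k+5"]] skip[of k] skip[of "k+1"] skip[of "k+3"] skip[of "k+4"]
        opp(1)[of k] opp(1)[of "k+1"] opp(2)[of "k+3"] opp(2)[of "k+4"] that
      by (simp add: eval_nat_numeral)
    then show False using skip[of "k + 2"] that by (simp add: eval_nat_numeral)
  qed
  define d where "d = j - i"
  have d: "j = i + d" "0 < d" "i + d < 8" using assms(9-) by (auto simp: d_def)
  show ?thesis
  proof (cases "odd d")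
    case True
    then show ?thesis using par[of i] par[of j] d by auto
  next
    case False
    then have "d = 2 \<or> d = 4 \<or> d = 6" using d by presburger
    then show ?thesis using four[of i] six[of i] skip[of i] d by (auto simp: eval_nat_numeral)
  qed
qed

section \<open>Green Veldkamp quadrangles as geometries\<close>

lemma length4E: "length xs = Suc 4 \<Longrightarrow> (\<And>a b c d e. xs = [a, b, c, d, e] \<Longrightarrow> thesis) \<Longrightarrow> thesis"
  by (auto simp: length_Suc_conv eval_nat_numeral)

text \<open>The interface shared by \<Gamma> and the quotient: local opposition is kept, while the
  polygon axioms are replaced by the geometry. The conjunct \<open>p \<in> P\<close> is there
  because \<open>adj\<close> is symmetric and would also hold with the line first.\<close>

locale green_quadrangle =
  fixes P L :: "'v set" and adj :: "'v \<Rightarrow> 'v \<Rightarrow> bool" and opp :: "'v \<Rightarrow> 'v \<Rightarrow> 'v \<Rightarrow> bool"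
  assumes adj_sym: "adj u v \<Longrightarrow> adj v u"
    and adj_sides: "adj u v \<Longrightarrow> u \<in> P \<and> v \<in> L \<or> u \<in> L \<and> v \<in> P"
    and disjoint: "P \<inter> L = {}"
    and nonempty: "P \<union> L \<noteq> {}"
    and opposition: "v \<in> P \<union> L \<Longrightarrow> opposition_rel (nbrs adj v) (opp v)"
    and plump_nbrs: "v \<in> P \<union> L \<Longrightarrow> plump 2 (nbrs adj v) (opp v)"
    and is_green: "green adj opp L"
    and geometry: "straight_geometry (\<lambda>p x. p \<in> P \<and> adj p x) (\<lambda>p x y. p \<in> P \<and> opp p x y)"

text \<open>A walk alternates sides, so the induction also needs a claim for walks that start at a
  line; it is made for all points on that line.\<close>

lemma walk_two_steps:
  assumes "walk adj xs" "last xs \<in> P"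
    and sides: "\<And>u v. adj u v \<Longrightarrow> u \<in> P \<and> v \<in> L \<or> u \<in> L \<and> v \<in> P"
    and sym: "\<And>u v. adj u v \<Longrightarrow> adj v u" and disj: "P \<inter> L = {}"
    and loop: "\<And>p. p \<in> P \<Longrightarrow> \<exists>x. adj p x"
  defines "col \<equiv> \<lambda>a b. \<exists>z. (a \<in> P \<and> adj a z) \<and> (b \<in> P \<and> adj b z)"
  shows "(hd xs \<in> P \<longrightarrow> col\<^sup>*\<^sup>* (hd xs) (last xs)) \<and>
         (hd xs \<in> L \<longrightarrow> (\<forall>r\<in>P. adj r (hd xs) \<longrightarrow> col\<^sup>*\<^sup>* r (last xs)))"
  using assms(1,2)
proof (induction xs)
  case (Cons x xs)
  show ?case
  proof (cases xs)
    case Nil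
    then show ?thesis using Cons disj by auto
  next
    case (Cons y ys)
    then have xy: "adj x y" and IH: "(y \<in> P \<longrightarrow> col\<^sup>*\<^sup>* y (last xs)) \<and>
         (y \<in> L \<longrightarrow> (\<forall>r\<in>P. adj r y \<longrightarrow> col\<^sup>*\<^sup>* r (last xs)))"
      using Cons.prems Cons.IH by auto
    have "col r y" if "r \<in> P" "adj r x" "y \<in> P" for r
      unfolding col_def using xy sym that by blast
    then have "col\<^sup>*\<^sup>* r (last xs)" if "r \<in> P" "adj r x" "y \<in> P" for r
      using IH that converse_rtranclp_into_rtranclp[of col r y] by blast
    then show ?thesis using IH sides[OF xy] xy disj Cons by auto
  qed
qed simp

theorem veldkamp_quadrangle_geometry:
  assumes vq: "veldkamp_quadrangle V adj opp P L" and gr: "green adj opp L"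
  shows "green_quadrangle P L adj opp"
proof -
  have V: "V = P \<union> L" and disj: "P \<inter> L = {}" and n: "veldkamp_ngon V adj opp 4"
    and bip: "\<And>x y. adj x y \<Longrightarrow> (x \<in> P \<longleftrightarrow> y \<in> L)"
    using vq unfolding veldkamp_quadrangle_def by blast+
  have graph: "\<And>x y. adj x y \<Longrightarrow> x \<in> V \<and> y \<in> V \<and> x \<noteq> y \<and> adj y x"
    and opp: "\<And>v. v \<in> V \<Longrightarrow> opposition_rel (nbrs adj v) (opp v)"
    and plump: "\<And>v. v \<in> V \<Longrightarrow> plump 2 (nbrs adj v) (opp v)"
    and conn: "connected_graph V adj"
    using n unfolding veldkamp_ngon_def veldkamp_graph_def is_graph_def by blast+
  have sides: "u \<in> P \<and> v \<in> L \<or> u \<in> L \<and> v \<in> P" if "adj u v" for u v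
    using graph[OF that] bip[OF that] V disj by blast
  have vp2: "ys = xs" if "1 \<le> k" "k \<le> 3" "is_path V adj k xs" "straight opp xs"
      "m \<le> k" "is_path V adj m ys" "straight opp ys" "hd ys = hd xs" "last ys = last xs" for k m xs ys
    using n that unfolding veldkamp_ngon_def by (auto simp del: One_nat_def)
  have osym: "opp v y x" and oadj: "adj v x" "adj v y" and one: "x \<noteq> y" if "v \<in> V" "opp v x y" for v x y
    using opp[OF that(1)] that(2) unfolding opposition_rel_def nbrs_def by blast+
  have green: "opp x p q" if "x \<in> L" "adj x p" "adj x q" "p \<noteq> q" for x p q
    using gr that unfolding green_def trivial_rel_def nbrs_def by blast
  \<comment> \<open>Trivial opposition at lines makes both 2-paths from \<open>p\<close> to
    \<open>q\<close> straight.\<close>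
  have digon: "x = y" if "p \<in> P" "adj p x" "adj q x" "adj p y" "adj q y" "p \<noteq> q" for p q x y
  proof -
    have "x \<in> L" "y \<in> L" using that sides disj by blast+
    then have "opp x p q" "opp y p q" using that graph green by blast+
    then have "[p, y, q] = [p, x, q]"
      using vp2[of 2 "[p, x, q]" 2 "[p, y, q]"] that graph by (auto simp: is_path_iff)
    then show ?thesis by simp
  qed
  have no3: "\<not> adj u z" if "adj u v" "adj v w" "adj w z" "u \<noteq> w" "v \<noteq> z" "opp v u w" "opp w v z" for u v w z
    using vp2[of 3 "[u, v, w, z]" 1 "[u, z]"] that graph by (auto simp: is_path_iff)
  have uniq3: "w = w'" if "adj u v" "adj v w" "adj w z" "u \<noteq> w" "v \<noteq> z" "opp v u w" "opp w v z"
       "adj u v'" "adj v' w'" "adj w' z" "u \<noteq> w'" "v' \<noteq> z" "opp v' u w'" "opp w' v' z" for u v w z v' w'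
    using vp2[of 3 "[u, v, w, z]" 3 "[u, v', w', z]"] that graph by (auto simp: is_path_iff)
  have third: "\<exists>z. opp v x z \<and> opp v y z" if pr: "v \<in> V" "adj v x" "adj v y" for v x y
  proof -
    have "card {x, y} \<le> 2" by (simp add: card_insert_if)
    then obtain z where "opp v z x" "opp v z y"
      using plump[OF pr(1)] pr unfolding plump_def nbrs_def
      by (auto dest!: spec[of _ "{x, y}"])
    then show ?thesis using osym pr by blast
  qed
  have loop: "\<exists>x. adj p x" if "p \<in> P" for p
    using plump[of p] that V unfolding plump_def nbrs_def by (auto dest!: spec[of _ "{}"])
  have close: "\<exists>s w. s \<noteq> p \<and> s \<noteq> r \<and> opp s z w \<and> opp p w x \<and> s \<in> P"
    if p: "p \<in> P" "adj p x" "p \<noteq> q" "q \<in> P" "opp q x y" "r \<in> P" "adj r y" "q \<noteq> r" "opp r y z" for p x q y r z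
  proof -
    let ?v = "[p, x, q, y, r, z]"
    have PV: "p \<in> V" "q \<in> V" "r \<in> V" using p V by auto
    have a: "adj p x" "adj x q" "adj q y" "adj y r" "adj r z"
      using p PV oadj graph by blast+
    have L: "x \<in> L" "y \<in> L" "z \<in> L" using a p sides disj by blast+
    have "is_path V adj 5 ?v" "straight opp ?v"
      using a p PV L V one green graph by (auto simp: is_path_iff)
    then obtain cs where cs: "closed_path V adj 8 cs" "straight_circuit opp cs" "path_in_circuit cs 5 ?v"
      using n unfolding veldkamp_ngon_def by auto
    then have len: "length cs = 9" and steps: "path_steps V adj cs" and hl: "hd cs = last cs"
      unfolding closed_path_def is_path_iff by auto
    have c_adj: "adj (cs ! i) (cs ! Suc i)" if "i < 8" for i
      using steps that len unfolding path_steps_iff by simp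
    have c_skip: "cs ! i \<noteq> cs ! Suc (Suc i)" if "i < 7" for i
      using steps that len unfolding path_steps_iff by simp
    have edge: "circuit_edge cs (cs ! i) (cs ! Suc i)" if "i < 8" for i
      unfolding circuit_edge_def using that len by auto
    \<comment> \<open>The closed path is a path in its own circuit, hence straight at every position
      except the base point.\<close>
    have "path_in_circuit cs 8 cs"
      unfolding path_in_circuit_def is_path_iff path_steps_iff using len edge c_skip by auto
    then have "straight opp cs" using cs(2) unfolding straight_circuit_def by blast
    then have c_opp: "opp (cs ! Suc i) (cs ! i) (cs ! Suc (Suc i))" if "i < 7" for i
      using straightD[OF \<open>straight opp cs\<close>, of i] that len by simp
    have c_V: "cs ! i \<in> V" if "i < 9" for i
      using steps nth_mem[of i cs] that len unfolding path_steps_iff by auto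
    have "cs ! i \<noteq> cs ! j" if "i < j" "j < 8" for i j
    proof (rule straight_arc_distinct[where adj = adj and P = P and opp = opp])
      show "opp (cs ! Suc i) (cs ! Suc (Suc i)) (cs ! i)" if "i < 6" for i
        by (rule osym[OF c_V c_opp]) (use that in simp_all)
      show "adj v u" if "adj u v" for u v using graph that by blast
      show "u \<in> P \<longleftrightarrow> v \<notin> P" if "adj u v" for u v using sides[OF that] disj by blast
      show "adj (cs ! i) (cs ! Suc i)" if "i < 7" for i using c_adj[of i] that by simp
      show "cs ! i \<noteq> cs ! Suc (Suc i)" if "i < 6" for i using c_skip[of i] that by simp
      show "opp (cs ! Suc i) (cs ! i) (cs ! Suc (Suc i))" if "i < 6" for i
        using c_opp[of i] that by simp
    qed (fact no3, fact uniq3, fact that, fact that)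
    moreover have "cs ! 8 = cs ! 0" using hl len hd_conv_nth[of cs] last_conv_nth[of cs] by (cases "cs = []") auto
    ultimately interpret octagon cs using len by unfold_locales
    \<comment> \<open>The letters are exchanged with respect to the claim: here \<open>w\<close> is
      the missing point and \<open>s\<close> the missing line.\<close>
    obtain w s where sw: "w \<noteq> p" "w \<noteq> r" "s \<noteq> x"  "opp z r w" "opp w z s" "opp s w p" "opp p s x"
      by (rule complete_path[OF cs(2,3)]) blast
    have "adj z w" using sw oadj L V by blast
    then have "w \<in> P" using L sides disj by blast
    then show ?thesis using sw by blast
  qed
  show ?thesis
  proof
    show "adj v u" if "adj u v" for u v using that graph by blast
    show "u \<in> P \<and> v \<in> L \<or> u \<in> L \<and> v \<in> P" if "adj u v" for u v using that sides by blast
    show "P \<union> L \<noteq> {}" using conn V by (auto simp: connected_graph_def)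
    fix p q r x y z assume *: "p \<in> P \<and> adj p x"
    show "\<exists>r. (r \<in> P \<and> adj r x) \<and> r \<noteq> p \<and> r \<noteq> q" if "q \<in> P \<and> adj q x"
    proof -
      have x: "x \<in> L" "x \<in> V" "adj x p" "adj x q" using * that graph sides disj by blast+
      then obtain r where r: "opp x p r" "opp x q r" using third by blast
      then have "adj x r" using oadj(2) x(2) by blast
      then have "r \<in> P" "adj r x" using x(1) sides[of x r] graph disj by blast+
      then show ?thesis using r one x by blast
    qed
    show "\<exists>z. (p \<in> P \<and> opp p x z) \<and> p \<in> P \<and> opp p y z" if "p \<in> P \<and> adj p y"
      using third[of p x y] that * graph by blast
    show "\<exists>s w. s \<noteq> p \<and> s \<noteq> r \<and> (s \<in> P \<and> opp s z w) \<and> p \<in> P \<and> opp p w x"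
      if "p \<noteq> q" "q \<in> P \<and> opp q x y" "r \<in> P \<and> adj r y" "q \<noteq> r" "r \<in> P \<and> opp r y z"
      using close[of p x q y r z] that * by blast
    show "(\<lambda>a b. \<exists>z. (a \<in> P \<and> adj a z) \<and> b \<in> P \<and> adj b z)\<^sup>*\<^sup>* p q" if pr: "q \<in> P \<and> adj q y"
    proof -
      obtain xs where "walk adj xs" "hd xs = p" "last xs = q"
        using conn pr * V unfolding connected_graph_def by blast
      then show ?thesis using walk_two_steps[of adj xs P L] sides graph disj loop pr * by blast
    qed
    show "x = y" if "q \<in> P \<and> adj q x" "p \<in> P \<and> adj p y" "q \<in> P \<and> adj q y" "p \<noteq> q"
      using digon that * by blast
    show "q = q'" if "p \<noteq> q" "q \<in> P \<and> opp q x y" "p \<in> P \<and> adj p x'" "p \<noteq> q'" "q' \<in> P \<and> opp q' x' y" for q' x'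
    proof -
      have qV: "q \<in> V" "q' \<in> V" using that V by auto
      have a: "adj x q" "adj q y" "adj x' q'" "adj q' y" using that qV oadj graph by blast+
      have "x \<in> L" "x' \<in> L" using * that sides disj by blast+
      then have "opp x p q" "opp x' p q'" using green * that a graph by blast+
      then show ?thesis using uniq3[of p x q y x' q'] a that * one qV by blast
    qed
  qed (use opp plump gr disj V oadj osym one in \<open>blast+\<close>)
qed

section \<open>From the geometry back to the Veldkamp axioms\<close>

context green_quadrangle
begin

sublocale straight_geometry "\<lambda>p x. p \<in> P \<and> adj p x" "\<lambda>p x y. p \<in> P \<and> opp p x y"
  by (rule geometry)

abbreviation incident :: "'v \<Rightarrow> 'v \<Rightarrow> bool" where
  "incident p x \<equiv> p \<in> P \<and> adj p x"

lemma adj_side: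
  assumes "adj u v" shows "u \<in> P \<longleftrightarrow> v \<in> L" "u \<in> L \<longleftrightarrow> v \<in> P" "u \<in> P \<longleftrightarrow> v \<notin> P"
  using adj_sides[OF assms] disjoint by auto

lemma incident_line: "adj p x \<Longrightarrow> p \<in> P \<Longrightarrow> x \<in> L"
  using adj_side by blast

lemma opp_adj: "\<lbrakk>v \<in> P \<union> L; opp v x y\<rbrakk> \<Longrightarrow> adj v x \<and> adj v y \<and> x \<noteq> y \<and> opp v y x"
  using opposition unfolding opposition_rel_def nbrs_def by blast

lemma opp_line: "x \<in> L \<Longrightarrow> opp x p q \<longleftrightarrow> adj x p \<and> adj x q \<and> p \<noteq> q"
  using opp_adj is_green unfolding green_def trivial_rel_def nbrs_def by blast

lemma point_on_line: "p \<in> P \<Longrightarrow> \<exists>x. adj p x"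
  using plump_nbrs[of p] unfolding plump_def nbrs_def by (auto dest!: spec[of _ "{}"])

lemma line_has_point: "x \<in> L \<Longrightarrow> \<exists>p. incident p x"
  using plump_nbrs[of x] adj_side(2) adj_sym unfolding plump_def nbrs_def by (auto dest!: spec[of _ "{}"])

text \<open>An edge between the ends would leave two points on two common lines.\<close>

lemma no_straight_triangle:
  assumes "adj u v" "adj v w" "adj w z" "u \<noteq> w" "v \<noteq> z" "opp v u w" "opp w v z"
  shows "\<not> adj u z"
proof
  assume uz: "adj u z"
  show False
  proof (cases "u \<in> P")
    case True
    then have "w \<in> P" "incident u v" "incident w v" "incident u z" "incident w z"
      using assms uz adj_sym adj_side by blast+
    then show False using unique_line assms by blast
  next
    case False
    then have "v \<in> P" "z \<in> P" "incident v u" "incident z u" "incident v w" "incident z w"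
      using assms uz adj_sym adj_side by blast+
    then show False using unique_line[of v u z w] assms by blast
  qed
qed

text \<open>\<open>unique_proj\<close> starts at a point; when \<open>u\<close> is a line, both
  paths are read backwards from the point \<open>z\<close>.\<close>

lemma straight_path_unique:
  assumes "adj u v" "adj v w" "adj w z" "u \<noteq> w" "v \<noteq> z" "opp v u w" "opp w v z"
    and "adj u v'" "adj v' w'" "adj w' z" "u \<noteq> w'" "v' \<noteq> z" "opp v' u w'" "opp w' v' z"
  shows "v = v' \<and> w = w'"
proof (cases "u \<in> P")
  case True
  then have P: "w \<in> P" "w' \<in> P" "incident u v" "incident u v'" "incident w v" "incident w' v'"
    using assms adj_sym adj_side by blast+
  then have "w = w'" using unique_proj[of u v w z v' w'] assms by blast
  then show ?thesis using unique_line[of u v w v'] P assms by blast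
next
  case False
  then have P: "v \<in> P" "v' \<in> P" "z \<in> P" "incident z w" "incident z w'" "incident v w" "incident v' w'"
    using False assms(1-3,8-10) assms(1-3,8-10)[THEN adj_side(3)] assms(1-3,8-10)[THEN adj_sym] by simp_all
  have "opp v w u" "opp v' w' u"
    using P(1,2) opp_adj[of v u w] opp_adj[of v' u w'] assms(6,13) by blast+
  then have "v = v'" using unique_proj[of z w v u w' v'] assms(5,12) P by blast
  then show ?thesis using unique_line[of z w v w'] P assms by blast
qed

text \<open>The 5-path is offered in both directions because \<open>straight_extends\<close> works
  from whichever of its ends is a point.\<close>

lemma straight_octagon:
  assumes adj: "adj v0 v1" "adj v1 v2" "adj v2 v3" "adj v3 v4" "adj v4 v5" "adj v5 v6" "adj v6 v7" "adj v7 v0"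
    and opp: "opp v1 v0 v2" "opp v2 v1 v3" "opp v3 v2 v4" "opp v4 v3 v5" "opp v5 v4 v6" "opp v6 v5 v7"
      "opp v7 v6 v0" "opp v0 v7 v1"
  defines "cs \<equiv> [v0, v1, v2, v3, v4, v5, v6, v7, v0]"
  shows "closed_path (P \<union> L) adj 8 cs" "straight_circuit opp cs"
    "path_in_circuit cs 5 [v0, v1, v2, v3, v4, v5]" "path_in_circuit cs 5 [v5, v4, v3, v2, v1, v0]"
proof -
  have V: "u \<in> P \<union> L \<and> v \<in> P \<union> L" if "adj u v" for u v using adj_sides[OF that] by blast
  have all_V: "v0 \<in> P \<union> L" "v1 \<in> P \<union> L" "v2 \<in> P \<union> L" "v3 \<in> P \<union> L" "v4 \<in> P \<union> L" "v5 \<in> P \<union> L"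
    "v6 \<in> P \<union> L" "v7 \<in> P \<union> L"
    using V adj by blast+
  have oppV: "v \<in> P \<union> L \<Longrightarrow> opp v x y \<Longrightarrow> x \<noteq> y \<and> opp v y x" for v x y using opp_adj by blast
  have ne: "v0 \<noteq> v2" "v1 \<noteq> v3" "v2 \<noteq> v4" "v3 \<noteq> v5" "v4 \<noteq> v6" "v5 \<noteq> v7" "v6 \<noteq> v0" "v7 \<noteq> v1"
    using oppV opp all_V by blast+
  have rev: "opp v1 v2 v0" "opp v2 v3 v1" "opp v3 v4 v2" "opp v4 v5 v3" "opp v5 v6 v4" "opp v6 v7 v5"
      "opp v7 v0 v6" "opp v0 v1 v7"
    using oppV opp all_V by blast+
  show "closed_path (P \<union> L) adj 8 cs"
    unfolding closed_path_def is_path_iff cs_def using adj ne all_V by simp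
  have six: "(\<forall>i<6. Q i) \<longleftrightarrow> Q 0 \<and> Q 1 \<and> Q 2 \<and> Q 3 \<and> Q 4 \<and> Q (5::nat)" for Q
    by (simp add: numeral_eq_Suc All_less_Suc2)
  have seven: "(\<forall>i<7. Q i) \<longleftrightarrow> Q 0 \<and> Q 1 \<and> Q 2 \<and> Q 3 \<and> Q 4 \<and> Q 5 \<and> Q (6::nat)" for Q
    by (simp add: numeral_eq_Suc All_less_Suc2)
  have c_adj: "\<forall>i<7. adj (cs ! i) (cs ! Suc i)" unfolding seven cs_def using adj by simp
  have c_ne: "\<forall>i<6. cs ! i \<noteq> cs ! Suc (Suc i)" unfolding six cs_def using ne by simp
  have c_opp: "\<forall>i<6. opp (cs ! Suc i) (cs ! i) (cs ! Suc (Suc i))" unfolding six cs_def using opp by simp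
  have c_rev: "\<forall>i<6. opp (cs ! Suc i) (cs ! Suc (Suc i)) (cs ! i)" unfolding six cs_def using rev by simp
  interpret octagon cs
  proof
    show "length cs = 9" "cs ! 8 = cs ! 0" by (simp_all add: cs_def)
    fix i j :: nat assume "i < j" "j < 8"
    show "cs ! i \<noteq> cs ! j"
    proof (rule straight_arc_distinct[where adj = adj and P = P and opp = opp])
      show "u \<in> P \<longleftrightarrow> v \<notin> P" if "adj u v" for u v using adj_side(3) that .
      show "w = w'" if "adj u v" "adj v w" "adj w z" "u \<noteq> w" "v \<noteq> z" "opp v u w" "opp w v z"
       "adj u v'" "adj v' w'" "adj w' z" "u \<noteq> w'" "v' \<noteq> z" "opp v' u w'" "opp w' v' z" for u v w z v' w'
        using straight_path_unique that by blast
      show "adj (cs ! i) (cs ! Suc i)" if "i < 7" for i using c_adj that by blast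
      show "cs ! i \<noteq> cs ! Suc (Suc i)" if "i < 6" for i using c_ne that by blast
      show "opp (cs ! Suc i) (cs ! i) (cs ! Suc (Suc i))" if "i < 6" for i using c_opp that by blast
      show "opp (cs ! Suc i) (cs ! Suc (Suc i)) (cs ! i)" if "i < 6" for i using c_rev that by blast
    qed (fact adj_sym, fact no_straight_triangle, fact \<open>i < j\<close>, fact \<open>j < 8\<close>)
  qed
  have eight: "(i = 0 \<or> i = 1 \<or> i = 2 \<or> i = 3 \<or> i = 4 \<or> i = 5 \<or> i = 6 \<or> i = 7)" if "i < 8" for i :: nat
    using that by linarith
  show "straight_circuit opp cs"
  proof (rule straight_circuitI)
    fix i :: nat assume "i < 8"
    show "opp (cs ! i) (cs ! ((i + 7) mod 8)) (cs ! ((i + 1) mod 8))"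
      using eight[OF \<open>i < 8\<close>] opp unfolding cs_def by (elim disjE) simp_all
    show "opp (cs ! i) (cs ! ((i + 1) mod 8)) (cs ! ((i + 7) mod 8))"
      using eight[OF \<open>i < 8\<close>] rev unfolding cs_def by (elim disjE) simp_all
  qed
  have edge: "circuit_edge cs (cs ! i) (cs ! Suc i) \<and> circuit_edge cs (cs ! Suc i) (cs ! i)" if "i < 7" for i
  proof -
    have "i + 1 < length cs" using that length_cs by simp
    then show ?thesis unfolding circuit_edge_def by (metis Suc_eq_plus1)
  qed
  then have "\<forall>i<7. circuit_edge cs (cs ! i) (cs ! Suc i) \<and> circuit_edge cs (cs ! Suc i) (cs ! i)" by blast
  then have e: "circuit_edge cs v0 v1" "circuit_edge cs v1 v2" "circuit_edge cs v2 v3"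
      "circuit_edge cs v3 v4" "circuit_edge cs v4 v5"
      "circuit_edge cs v1 v0" "circuit_edge cs v2 v1" "circuit_edge cs v3 v2"
      "circuit_edge cs v4 v3" "circuit_edge cs v5 v4"
    unfolding seven by (simp_all add: cs_def)
  have "v0 \<in> set cs" "v1 \<in> set cs" "v2 \<in> set cs" "v3 \<in> set cs" "v4 \<in> set cs" "v5 \<in> set cs"
    by (simp_all add: cs_def)
  with e ne show "path_in_circuit cs 5 [v0, v1, v2, v3, v4, v5]" "path_in_circuit cs 5 [v5, v4, v3, v2, v1, v0]"
    unfolding path_in_circuit_def is_path_iff by auto
qed

text \<open>Bipartiteness excludes lengths \<open>m\<close> of the wrong parity. The remaining
  shorter path would mean backtracking or a triangle, and equal lengths are \<open>digon\<close> and
  \<open>straight_path_unique\<close>.\<close>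

lemma straight_uniqueness:
  assumes k: "1 \<le> k" "k \<le> 3" "m \<le> k"
    and xs: "is_path (P \<union> L) adj k xs" "straight opp xs"
    and ys: "is_path (P \<union> L) adj m ys" "straight opp ys"
    and ends: "hd ys = hd xs" "last ys = last xs"
  shows "ys = xs"
proof -
  have digon: "b = b'" if "adj a b" "adj b c" "adj a b'" "adj b' c" "a \<noteq> c" for a b b' c
  proof (cases "a \<in> P")
    case True
    then show ?thesis using unique_line[of a b c b'] that adj_sym adj_side(1,2)[of a b] adj_side(1,2)[of b c] by blast
  next
    case False
    then show ?thesis using unique_line[of b a b' c] that adj_sym adj_side(3)[of a b] adj_side(3)[of a b'] by blast
  qed
  have par: "u \<in> P \<longleftrightarrow> v \<notin> P" if "adj u v" for u v using adj_side(3) that .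
  have irr: "\<not> adj u u" for u using par by blast
  consider "k = 1" | "k = 2" | "k = 3" using k by linarith
  then show ?thesis
  proof cases
    case 1
    obtain a b where [simp]: "xs = [a, b]" using xs 1 by (auto simp: is_path_iff length_Suc_conv)
    have "m = 0 \<or> m = 1" using k 1 by linarith
    then show ?thesis using xs ys ends irr by (auto simp: is_path_iff length_Suc_conv)
  next
    case 2
    obtain a b c where [simp]: "xs = [a, b, c]"
      using xs 2 by (auto simp: is_path_iff length_Suc_conv eval_nat_numeral)
    have x: "adj a b" "adj b c" "a \<noteq> c" using xs by (auto simp: is_path_iff)
    consider "m = 0" | "m = 1" | "m = 2" using k 2 by linarith
    then show ?thesis
    proof cases
      case 1
      then show ?thesis using ys ends x by (auto simp: is_path_iff length_Suc_conv)
    next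
      case 2
      then have "adj a c" using ys ends by (auto simp: is_path_iff length_Suc_conv)
      then show ?thesis using par x by blast
    next
      case 3
      then obtain b' where "ys = [a, b', c]"
        using ys ends by (auto simp: is_path_iff length_Suc_conv eval_nat_numeral)
      then show ?thesis using ys digon x by (auto simp: is_path_iff)
    qed
  next
    case 3
    obtain a b c d where [simp]: "xs = [a, b, c, d]"
      using xs 3 by (auto simp: is_path_iff length_Suc_conv eval_nat_numeral)
    have x: "adj a b" "adj b c" "adj c d" "a \<noteq> c" "b \<noteq> d" "opp b a c" "opp c b d"
      using xs by (auto simp: is_path_iff)
    consider "m = 0" | "m = 1" | "m = 2" | "m = 3" using k 3 by linarith
    then show ?thesis
    proof cases
      case 1
      then have "a = d" using ys ends by (auto simp: is_path_iff length_Suc_conv)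
      then show ?thesis using par x by blast
    next
      case 2
      then have "adj a d" using ys ends by (auto simp: is_path_iff length_Suc_conv)
      then show ?thesis using no_straight_triangle x by blast
    next
      case 3
      then obtain b' where "adj a b'" "adj b' d"
        using ys ends by (auto simp: is_path_iff length_Suc_conv eval_nat_numeral)
      then show ?thesis using par x by blast
    next
      case 4
      then obtain b' c' where y: "ys = [a, b', c', d]"
        using ys ends by (auto simp: is_path_iff length_Suc_conv eval_nat_numeral)
      then have "adj a b'" "adj b' c'" "adj c' d" "a \<noteq> c'" "b' \<noteq> d" "opp b' a c'" "opp c' b' d"
        using ys by (auto simp: is_path_iff)
      then have "b = b' \<and> c = c'" using straight_path_unique x by blast
      then show ?thesis using y by simp
    qed
  qed
qed

text \<open>\<open>close_path\<close> starts at a point; a path of odd length has one end on each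
  side, so it or its reverse qualifies.\<close>

lemma straight_extends:
  assumes "is_path (P \<union> L) adj 5 xs" "straight opp xs"
  shows "\<exists>cs. closed_path (P \<union> L) adj 8 cs \<and> straight_circuit opp cs \<and> path_in_circuit cs 5 xs"
proof -
  obtain v0 v1 v2 v3 v4 v5 where v: "xs = [v0, v1, v2, v3, v4, v5]"
    using assms(1) by (auto simp: is_path_iff length_Suc_conv eval_nat_numeral)
  have main: "\<exists>w6 w7. closed_path (P \<union> L) adj 8 [w0, w1, w2, w3, w4, w5, w6, w7, w0] \<and>
      straight_circuit opp [w0, w1, w2, w3, w4, w5, w6, w7, w0] \<and>
      path_in_circuit [w0, w1, w2, w3, w4, w5, w6, w7, w0] 5 [w0, w1, w2, w3, w4, w5] \<and>
      path_in_circuit [w0, w1, w2, w3, w4, w5, w6, w7, w0] 5 [w5, w4, w3, w2, w1, w0]"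
    if adj: "adj w0 w1" "adj w1 w2" "adj w2 w3" "adj w3 w4" "adj w4 w5"
      and ne: "w0 \<noteq> w2" "w2 \<noteq> w4"
      and opp: "opp w1 w0 w2" "opp w2 w1 w3" "opp w3 w2 w4" "opp w4 w3 w5" and P: "w0 \<in> P"
    for w0 w1 w2 w3 w4 w5
  proof -
    have side: "w1 \<in> L" "w2 \<in> P" "w3 \<in> L" "w4 \<in> P" "w5 \<in> L"
      using P adj_side(1,2)[OF adj(1)] adj_side(1,2)[OF adj(2)] adj_side(1,2)[OF adj(3)]
        adj_side(1,2)[OF adj(4)] adj_side(1,2)[OF adj(5)] by blast+
    obtain w6 w7 where w: "w6 \<noteq> w0" "w6 \<noteq> w4" "w6 \<in> P" "opp w6 w5 w7" "opp w0 w7 w1"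
      using close_path[of w0 w1 w2 w3 w4 w5] P side adj opp adj_sym ne by blast
    have a: "adj w5 w6" "adj w6 w7" "adj w7 w0"
      using opp_adj[of w6 w5 w7] opp_adj[of w0 w7 w1] w P adj_sym by blast+
    then have "opp w5 w4 w6" "opp w7 w6 w0"
      using opp_line side w adj adj_sym adj_side by blast+
    then show ?thesis using straight_octagon[OF adj a opp] w by blast
  qed
  have p: "adj v0 v1" "adj v1 v2" "adj v2 v3" "adj v3 v4" "adj v4 v5"
     "v0 \<noteq> v2" "v1 \<noteq> v3" "v2 \<noteq> v4" "v3 \<noteq> v5"
     "opp v1 v0 v2" "opp v2 v1 v3" "opp v3 v2 v4" "opp v4 v3 v5"
    "v1 \<in> P \<union> L" "v2 \<in> P \<union> L" "v3 \<in> P \<union> L" "v4 \<in> P \<union> L"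
    using assms v by (auto simp: is_path_iff)
  show ?thesis
  proof (cases "v0 \<in> P")
    case True
    then show ?thesis using main[of v0 v1 v2 v3 v4 v5] p v by blast
  next
    case False
    then have "v5 \<in> P" using p(1-5)[THEN adj_side(3)] by blast
    moreover have "opp v4 v5 v3" "opp v3 v4 v2" "opp v2 v3 v1" "opp v1 v2 v0"
      using p opp_adj by blast+
    ultimately show ?thesis using main[of v5 v4 v3 v2 v1 v0] p(1-9) adj_sym v by metis
  qed
qed

lemma connected: "connected_graph (P \<union> L) adj"
proof -
  have trans: "adj\<^sup>*\<^sup>* u v \<Longrightarrow> \<exists>xs. walk adj xs \<and> hd xs = u \<and> last xs = v" for u v
  proof (induction rule: converse_rtranclp_induct)
    case base
    have "walk adj [v]" by simp
    then show ?case by (metis last.simps list.sel(1))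
  next
    case (step u w)
    then obtain xs where "walk adj xs" "hd xs = w" "last xs = v" by blast
    then have "walk adj (u # xs)" "hd (u # xs) = u" "last (u # xs) = v"
      using step(1) by (cases xs; simp)+
    then show ?case by blast
  qed
  have pts: "adj\<^sup>*\<^sup>* p q" if pq: "p \<in> P" "q \<in> P" for p q
  proof -
    obtain x y where xy: "adj p x" "adj q y" using pq[THEN point_on_line] by blast
    obtain r where r: "r \<in> P" "adj r y" "col r p"
      using projection_exists[of p x q y] pq xy by blast
    then obtain z where "adj r z" "adj p z" by (auto simp: col_def)
    then show ?thesis using r xy adj_sym
      by (meson converse_rtranclp_into_rtranclp rtranclp.rtrancl_refl)
  qed
  have "\<exists>p\<in>P. adj\<^sup>*\<^sup>* u p \<and> adj\<^sup>*\<^sup>* p u" if "u \<in> P \<union> L" for u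
    using that line_has_point[of u] adj_sym by (meson UnE r_into_rtranclp rtranclp.rtrancl_refl)
  then have "adj\<^sup>*\<^sup>* u v" if "u \<in> P \<union> L" "v \<in> P \<union> L" for u v
    using that pts by (meson rtranclp_trans)
  then show ?thesis unfolding connected_graph_def using trans nonempty by blast
qed

theorem veldkamp_quadrangle: "veldkamp_quadrangle (P \<union> L) adj opp P L"
proof -
  have "is_graph (P \<union> L) adj"
    unfolding is_graph_def using adj_side(3) adj_sides adj_sym by blast
  moreover have "bipartite_graph (P \<union> L) adj"
    unfolding bipartite_graph_def using disjoint adj_side(1) by blast
  ultimately have "veldkamp_ngon (P \<union> L) adj opp 4"
    unfolding veldkamp_ngon_def veldkamp_graph_def
    using opposition plump_nbrs connected straight_uniqueness straight_extends by auto
  then show ?thesis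
    unfolding veldkamp_quadrangle_def using disjoint adj_side(1) by blast
qed

section \<open>Distance, weeds and the two class relations\<close>

lemma col_walk:
  assumes "walk adj xs" "hd xs \<in> P" "last xs \<in> P" "length xs \<le> 4"
  shows "col (hd xs) (last xs)"
proof -
  have loop: "col p p" if "p \<in> P" for p using point_on_line that by (auto simp: col_def)
  have "length xs = 0 \<or> length xs = 1 \<or> length xs = 2 \<or> length xs = 3 \<or> length xs = 4"
    using assms(4) by linarith
  then consider "xs = []" | a where "xs = [a]" | a b where "xs = [a, b]" | a b c where "xs = [a, b, c]"
    | a b c d where "xs = [a, b, c, d]"
    by (auto simp: length_Suc_conv eval_nat_numeral)
  then show ?thesis
  proof cases
    case (4 a b c)
    then show ?thesis using assms adj_sym by (auto simp: col_def)
  next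
    case (5 a b c d)
    then show ?thesis using assms adj_side(3)[of a b] adj_side(3)[of b c] adj_side(3)[of c d] by auto
  qed (use assms loop adj_side(3) in \<open>auto\<close>)
qed

text \<open>By parity, a walk between points with fewer than four edges has at most two, and then
  its ends are collinear or equal.\<close>

lemma gdist_4_iff:
  assumes "adj a x" "adj x b" "adj b y" "adj y c" "a \<in> P" "c \<in> P"
  shows "gdist adj a c = 4 \<longleftrightarrow> \<not> col a c"
proof
  let ?Q = "\<lambda>n. \<exists>xs. walk adj xs \<and> length xs = n + 1 \<and> hd xs = a \<and> last xs = c"
  have Q4: "?Q 4" by (rule exI[of _ "[a, x, b, y, c]"]) (use assms in simp)
  {
    assume "gdist adj a c = 4"
    show "\<not> col a c"
    proof
      assume "col a c"
      then obtain z where "adj a z" "adj z c" using adj_sym by (auto simp: col_def)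
      then have "walk adj [a, z, c]" by simp
      then have "?Q 2" by (intro exI[of _ "[a, z, c]"]) simp
      then have "gdist adj a c \<le> 2" unfolding gdist_def by (rule Least_le)
      then show False using \<open>gdist adj a c = 4\<close> by simp
    qed
  next
    assume nc: "\<not> col a c"
    show "gdist adj a c = 4"
      unfolding gdist_def
    proof (rule Least_equality[of ?Q, OF Q4])
      fix n assume "?Q n"
      then obtain xs where "walk adj xs" "length xs = n + 1" "hd xs = a" "last xs = c" by blast
      then show "4 \<le> n" using col_walk[of xs] nc assms by force
    qed
  }
qed

text \<open>A weed can fail to be straight only at its middle point. By \<open>far_straight\<close>,
  one such failure already shows that the ends are not opposite.\<close>

lemma weed_iff:
  "weed (P \<union> L) adj opp P w \<longleftrightarrow> (\<exists>a x b y c. w = [a, x, b, y, c] \<and> incident a x \<and> incident b x \<and>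
     incident b y \<and> incident c y \<and> sim a c)"
proof
  assume w: "weed (P \<union> L) adj opp P w"
  then have "length w = Suc 4" by (simp add: weed_def is_path_iff)
  then obtain a x b y c where v: "w = [a, x, b, y, c]" by (rule length4E)
  then have p: "adj a x" "adj x b" "adj b y" "adj y c" "a \<in> P" "b \<in> P" "c \<in> P" "a \<noteq> b" "b \<noteq> c"
    and ns: "\<not> straight opp w" and d: "gdist adj a c = 4"
    using w unfolding weed_def is_path_iff by auto
  have L: "x \<in> L" "y \<in> L" using p incident_line adj_sym by blast+
  have nc: "\<not> col a c" using gdist_4_iff p d by blast
  have on: "incident a x" "incident b x" "incident b y" "incident c y" using p adj_sym by blast+
  have "\<not> opp b x y" using ns v p L opp_line adj_sym by auto
  then have "\<not> far a c" using far_straight[OF _ on] by blast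
  then have "sim a c" using nc on by (auto simp: sim_def col_def)
  then show "\<exists>a x b y c. w = [a, x, b, y, c] \<and> incident a x \<and> incident b x \<and>
     incident b y \<and> incident c y \<and> sim a c" using v on by blast
next
  assume "\<exists>a x b y c. w = [a, x, b, y, c] \<and> incident a x \<and> incident b x \<and>
     incident b y \<and> incident c y \<and> sim a c"
  then obtain a x b y c where w: "w = [a, x, b, y, c]"
    and on: "incident a x" "incident b x" "incident b y" "incident c y" and s: "sim a c" by blast
  have nc: "\<not> col a c" "\<not> far a c" using s by (auto simp: sim_def)
  have L: "x \<in> L" "y \<in> L" using on incident_line by blast+
  have ne: "x \<noteq> y" "a \<noteq> b" "b \<noteq> c" using nc on by (auto simp: col_def)
  have "is_path (P \<union> L) adj 4 w" unfolding is_path_iff using w on L ne nc adj_sym by (auto simp: col_def)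
  moreover have "\<not> opp b x y" using farI[of b x y a c] nc on ne by blast
  then have "\<not> straight opp w" using w by simp
  moreover have "gdist adj a c = 4" using gdist_4_iff[of a x b y c] on nc adj_sym by blast
  ultimately show "weed (P \<union> L) adj opp P w" unfolding weed_def using w on by simp
qed

text \<open>Combines \<open>sim_eqv\<close> with \<open>eqv_sim\<close>; transitivity of the weed
  relation comes for free from the form of \<open>eqv\<close>.\<close>

lemma pequiv_iff:
  assumes "a \<in> P" "b \<in> P" shows "pequiv (P \<union> L) adj opp P a b \<longleftrightarrow> eqv a b"
proof -
  have "(\<exists>w. weed (P \<union> L) adj opp P w \<and> w ! 0 = a \<and> w ! 4 = b) \<longleftrightarrow> sim a b"
    unfolding weed_iff
  proof
    assume s: "sim a b"
    then obtain x c y where "incident a x" "incident c x" "incident c y" "incident b y"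
      by (auto simp: sim_def col_def)
    then show "\<exists>w. (\<exists>a x b y c. w = [a, x, b, y, c] \<and> incident a x \<and> incident b x \<and>
     incident b y \<and> incident c y \<and> sim a c) \<and> w ! 0 = a \<and> w ! 4 = b"
      using s by (intro exI[of _ "[a, x, c, y, b]"]) auto
  qed auto
  moreover have "eqv a b \<longleftrightarrow> a = b \<or> sim a b"
  proof -
    obtain x y where "incident a x" "incident b y" using assms[THEN point_on_line] assms by blast
    then show ?thesis using sim_eqv eqv_sim[of a x b y] by auto
  qed
  ultimately show ?thesis
    unfolding pequiv_def by blast
qed

lemma pclass_eq: "a \<in> P \<Longrightarrow> pclass (P \<union> L) adj opp P a = {b \<in> P. eqv a b}"
  unfolding pclass_def using pequiv_iff by blast

text \<open>The two lines of a weed share its middle point and carry its equivalent ends, so they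
  agree in two classes.\<close>

lemma lsim_leq: "lsim (P \<union> L) adj opp P L x y \<Longrightarrow> leq x y"
proof -
  assume "lsim (P \<union> L) adj opp P L x y"
  then obtain a u b v c where w: "x \<in> L" "y \<in> L" "x \<in> {a, u, b, v, c}" "y \<in> {a, u, b, v, c}"
    and on: "incident a u" "incident b u" "incident b v" "incident c v" and s: "sim a c"
    unfolding lsim_def weed_iff by auto
  have "a \<noteq> b" using s on by (auto simp: sim_def col_def)
  then have "leq u v" using leqI[OF on(1,2) _ on(4,3)] s sim_eqv by simp
  moreover have "x = u \<or> x = v" "y = u \<or> y = v" using w on disjoint by auto
  ultimately show "leq x y" using leq_sym leq_refl by blast
qed

lemma lsimI:
  assumes "incident b x" "incident b y" "incident a x" "incident c y" "eqv a c" "a \<noteq> c"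
  shows "lsim (P \<union> L) adj opp P L x y"
proof -
  have "sim a c" using eqv_sim assms by blast
  then have "weed (P \<union> L) adj opp P [a, x, b, y, c]" unfolding weed_iff using assms by blast
  moreover have "x \<in> L" "y \<in> L" using assms incident_line by blast+
  moreover have "x \<in> set [a, x, b, y, c]" "y \<in> set [a, x, b, y, c]" by auto
  ultimately show ?thesis unfolding lsim_def by blast
qed

text \<open>Meeting lines with equal perps coincide or form one weed. In general a line
  \<open>w\<close> from a point \<open>b\<close> of \<open>x\<close> to a point \<open>c\<close> of
  \<open>y\<close> equivalent to a point of \<open>x\<close> has the same perp and meets both, so
  two weeds suffice.\<close>

lemma leq_lsim:
  assumes "x \<in> L" "y \<in> L" "leq x y"
  shows "(lsim (P \<union> L) adj opp P L)\<^sup>*\<^sup>* x y"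
proof -
  let ?s = "(lsim (P \<union> L) adj opp P L)\<^sup>*\<^sup>*"
  have meet: "?s u v" if uv: "incident b u" "incident b v" "leq u v" for b u v
  proof -
    obtain a where a: "incident a u" "a \<noteq> b" using third_point[OF uv(1) uv(1)] by blast
    obtain c where c: "incident c v" "eqv a c" using leq_point uv a by blast
    show ?thesis
    proof (cases "a = c")
      case True
      then have "u = v" using unique_line[of a u b v] a c uv by blast
      then show ?thesis by simp
    next
      case False
      then show ?thesis using lsimI[of b u v a c] uv a c by blast
    qed
  qed
  obtain a where a: "incident a x" using line_has_point assms by blast
  obtain r where "incident r y" using line_has_point assms by blast
  then obtain c where c: "incident c y" "eqv a c" using leq_point[OF assms(3) a] by blast
  obtain b where b: "incident b x" "b \<noteq> a" using third_point[OF a a] by blast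
  have "\<not> eqv b c"
  proof
    assume "eqv b c"
    then have "eqv b a" using c eqv_trans eqv_sym by blast
    then show False using eqv_on_line_eq[OF b(1) a] b by blast
  qed
  moreover have "\<not> far b a" using a b col_not_far by (auto simp: col_def)
  then have "\<not> far b c" using eqv_far c eqv_refl by blast
  ultimately have "col b c" using col_or_sim[OF b(1) c(1)] sim_eqv by blast
  then obtain w where w: "incident b w" "incident c w" by (auto simp: col_def)
  have "leq x w" using leqI[OF a b(1) _ w(2) w(1)] c b by simp
  moreover from this have "leq w y" using leq_trans leq_sym assms by blast
  ultimately have "?s x w" "?s w y" using meet b w c by blast+
  then show ?thesis by simp
qed

lemma lclass_eq: "x \<in> L \<Longrightarrow> lclass (P \<union> L) adj opp P L x = {y \<in> L. leq x y}"
proof -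
  have "(lsim (P \<union> L) adj opp P L)\<^sup>*\<^sup>* x y \<Longrightarrow> leq x y" for y
  proof (induction rule: rtranclp_induct)
    case (step y z)
    then show ?case using lsim_leq leq_trans by blast
  qed simp
  then show "x \<in> L \<Longrightarrow> ?thesis" unfolding lclass_def using leq_lsim by blast
qed

section \<open>Opposite sets and flatness\<close>

lemma opposite_iff: "opposite (P \<union> L) adj opp 4 x y \<longleftrightarrow> x \<in> P \<and> far x y \<or> x \<in> L \<and> lfar x y"
proof
  assume "opposite (P \<union> L) adj opp 4 x y"
  then obtain xs where xs: "is_path (P \<union> L) adj 4 xs" "straight opp xs" "hd xs = x" "last xs = y"
    by (auto simp: opposite_def)
  then have "length xs = Suc 4" by (simp add: is_path_iff)
  then obtain u b v where v: "xs = [x, u, b, v, y]" using xs(3,4) by (elim length4E) auto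
  then have p: "adj x u" "adj u b" "adj b v" "adj v y" "opp u x b" "opp b u v" "opp v b y" "x \<noteq> b" "u \<noteq> v" "b \<noteq> y"
    using xs(1,2) by (auto simp: is_path_iff)
  show "x \<in> P \<and> far x y \<or> x \<in> L \<and> lfar x y"
  proof (cases "x \<in> P")
    case True
    then have "b \<in> P" "y \<in> P" using p adj_side(1,2) by metis+
    then have "far x y" using farI[of b u v x y] p True adj_sym by blast
    then show ?thesis using True by blast
  next
    case False
    then have "x \<in> L" "u \<in> P" "v \<in> P" using p adj_side adj_sides by metis+
    then show ?thesis using p lfar_def by blast
  qed
next
  assume "x \<in> P \<and> far x y \<or> x \<in> L \<and> lfar x y"
  then show "opposite (P \<union> L) adj opp 4 x y"
  proof
    assume "x \<in> P \<and> far x y"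
    then obtain u b v where p: "incident x u" "x \<noteq> b" "b \<in> P" "opp b u v" "incident y v" "y \<noteq> b"
      unfolding far_def by blast
    have b: "adj b u" "adj b v" "u \<noteq> v" using opp_adj p by blast+
    then have L: "u \<in> L" "v \<in> L" using p incident_line by blast+
    then have "opp u x b" "opp v b y" using opp_line p b adj_sym by blast+
    then have "is_path (P \<union> L) adj 4 [x, u, b, v, y]" "straight opp [x, u, b, v, y]"
      using p b L adj_sym by (auto simp: is_path_iff)
    then show ?thesis unfolding opposite_def by (metis last.simps list.sel(1) list.distinct(1))
  next
    assume "x \<in> L \<and> lfar x y"
    then obtain u b v where p: "x \<in> L" "u \<in> P" "opp u x b" "u \<noteq> v" "v \<in> P" "opp v b y"
      unfolding lfar_def by blast
    have b: "adj u x" "adj u b" "adj v b" "adj v y" "x \<noteq> b" "b \<noteq> y" using opp_adj p by blast+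
    then have L: "b \<in> L" "y \<in> L" using p incident_line by blast+
    then have "opp b u v" using opp_line p b adj_sym by blast
    then have "is_path (P \<union> L) adj 4 [x, u, b, v, y]" "straight opp [x, u, b, v, y]"
      using p b L adj_sym by (auto simp: is_path_iff)
    then show ?thesis unfolding opposite_def by (metis last.simps list.sel(1) list.distinct(1))
  qed
qed

lemma op_set_point: "x \<in> P \<Longrightarrow> op_set (P \<union> L) adj opp 4 x = {y. far x y}"
  using disjoint unfolding op_set_def opposite_iff by blast

lemma op_set_line: "x \<in> L \<Longrightarrow> op_set (P \<union> L) adj opp 4 x = {y. lfar x y}"
  using disjoint unfolding op_set_def opposite_iff by blast

lemma far_point: "far x y \<Longrightarrow> y \<in> P"
  by (auto simp: far_def)

lemma lfar_line: "lfar x y \<Longrightarrow> y \<in> L"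
  using opp_adj incident_line unfolding lfar_def by blast

lemma far_exists: "x \<in> P \<Longrightarrow> \<exists>y. far x y"
proof -
  assume "x \<in> P"
  then obtain u where u: "incident x u" using point_on_line by blast
  then obtain q where q: "incident q u" "q \<noteq> x" using third_point[OF u u] by blast
  then show ?thesis using u by (elim separate[of q u]) blast
qed

lemma eqv_op_set:
  "\<lbrakk>x \<in> P; y \<in> P\<rbrakk> \<Longrightarrow> op_set (P \<union> L) adj opp 4 x = op_set (P \<union> L) adj opp 4 y \<longleftrightarrow> eqv x y"
  unfolding op_set_point eqv_def by blast

text \<open>When equivalent points coincide, \<open>leq_point\<close> puts every point of
  \<open>x\<close> on \<open>y\<close>, and two common points suffice.\<close>

lemma leq_imp_eq:
  assumes eq: "\<And>a c. \<lbrakk>a \<in> P; c \<in> P; eqv a c\<rbrakk> \<Longrightarrow> a = c" and "x \<in> L" "y \<in> L" "leq x y"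
  shows "x = y"
proof -
  obtain a where a: "incident a x" using line_has_point assms by blast
  obtain b where b: "incident b x" "b \<noteq> a" using third_point[OF a a] by blast
  obtain r where r: "incident r y" using line_has_point assms by blast
  have "incident p y" if p: "incident p x" for p
    by (rule leq_point[OF assms(4) p r]) (use eq p in blast)
  then show ?thesis using unique_line[of a x b y] a b by blast
qed

text \<open>Opposite vertices lie on the same side and a point has some opposite, so a point never
  shares its opposite set with a line. Lines reduce to points by \<open>lfar_leq\<close> and
  \<open>leq_imp_eq\<close>.\<close>

lemma flatI:
  assumes eq: "\<And>a c. \<lbrakk>a \<in> P; c \<in> P; eqv a c\<rbrakk> \<Longrightarrow> a = c"
  shows "flat (P \<union> L) adj opp 4"
  unfolding flat_def
proof (intro ballI impI)
  fix x y assume xy: "x \<in> P \<union> L" "y \<in> P \<union> L"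
    and op: "op_set (P \<union> L) adj opp 4 x = op_set (P \<union> L) adj opp 4 y"
  have mixed: False if "p \<in> P" "l \<in> L" "op_set (P \<union> L) adj opp 4 p = op_set (P \<union> L) adj opp 4 l" for p l
  proof -
    obtain q where "far p q" using far_exists \<open>p \<in> P\<close> by blast
    then have "q \<in> P" using far_point by blast
    moreover have "lfar l q"
      using \<open>far p q\<close> that op_set_point[OF \<open>p \<in> P\<close>] op_set_line[OF \<open>l \<in> L\<close>] by auto
    ultimately show False using lfar_line disjoint by blast
  qed
  consider "x \<in> P" "y \<in> P" | "x \<in> L" "y \<in> L" using xy op mixed[of x y] mixed[OF _ _ op[symmetric]] by blast
  then show "x = y"
  proof cases
    case 1
    then show ?thesis using eq eqv_op_set op by blast
  next
    case 2
    then have "{z. lfar x z} = {z. lfar y z}" using op by (simp add: op_set_line)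
    then have "leq x y" by (intro lfar_leq) blast
    then show ?thesis using leq_imp_eq eq 2 by blast
  qed
qed

lemma flat_iff: "flat (P \<union> L) adj opp 4 \<longleftrightarrow> (\<forall>a\<in>P. \<forall>c\<in>P. eqv a c \<longrightarrow> a = c)"
proof
  assume f: "flat (P \<union> L) adj opp 4"
  show "\<forall>a\<in>P. \<forall>c\<in>P. eqv a c \<longrightarrow> a = c"
    using f eqv_op_set unfolding flat_def by blast
qed (use flatI in blast)

lemma flat_iff_singletons:
  "flat (P \<union> L) adj opp 4 \<longleftrightarrow>
     (\<forall>a\<in>P. pclass (P \<union> L) adj opp P a = {a}) \<and> (\<forall>x\<in>L. lclass (P \<union> L) adj opp P L x = {x})"
proof
  assume "flat (P \<union> L) adj opp 4"
  then have eq: "a = c" if "a \<in> P" "c \<in> P" "eqv a c" for a c using flat_iff that by blast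
  have "pclass (P \<union> L) adj opp P a = {a}" if "a \<in> P" for a
    using pclass_eq eq that by auto
  moreover have "lclass (P \<union> L) adj opp P L x = {x}" if "x \<in> L" for x
    using lclass_eq leq_imp_eq[OF eq] that by auto
  ultimately show "(\<forall>a\<in>P. pclass (P \<union> L) adj opp P a = {a}) \<and> (\<forall>x\<in>L. lclass (P \<union> L) adj opp P L x = {x})"
    by blast
next
  assume s: "(\<forall>a\<in>P. pclass (P \<union> L) adj opp P a = {a}) \<and> (\<forall>x\<in>L. lclass (P \<union> L) adj opp P L x = {x})"
  have "a = c" if "a \<in> P" "c \<in> P" "eqv a c" for a c
  proof -
    have "c \<in> pclass (P \<union> L) adj opp P a" using that pclass_eq by simp
    then show ?thesis using s that by simp
  qed
  then show "flat (P \<union> L) adj opp 4" by (rule flatI)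
qed

end

section \<open>The quotient\<close>

context green_quadrangle
begin

abbreviation "point_class a \<equiv> pclass (P \<union> L) adj opp P a"
abbreviation "line_class x \<equiv> lclass (P \<union> L) adj opp P L x"
abbreviation "PB \<equiv> Pbar (P \<union> L) adj opp P"
abbreviation "LB \<equiv> Lbar (P \<union> L) adj opp P L"
abbreviation "adjB \<equiv> adjbar (P \<union> L) adj opp P L"
abbreviation "oppB \<equiv> oppbar (P \<union> L) adj opp P L"

section \<open>Adjacency and opposition on representatives\<close>

lemma point_class_eq_iff:
  assumes "a \<in> P" "b \<in> P" shows "point_class a = point_class b \<longleftrightarrow> eqv a b"
  unfolding assms[THEN pclass_eq] using assms eqv_refl eqv_sym eqv_trans by blast

lemma line_class_eq_iff:
  assumes "x \<in> L" "y \<in> L" shows "line_class x = line_class y \<longleftrightarrow> leq x y"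
  unfolding assms[THEN lclass_eq] using assms leq_refl leq_sym leq_trans by blast

lemma point_class_in: "a \<in> P \<Longrightarrow> point_class a \<in> PB"
  by (simp add: Pbar_def)

lemma line_class_in: "x \<in> L \<Longrightarrow> line_class x \<in> LB"
  by (simp add: Lbar_def)

lemma in_PB: "\<lbrakk>A \<in> PB; a \<in> A\<rbrakk> \<Longrightarrow> a \<in> P \<and> A = point_class a"
  using pclass_eq point_class_eq_iff unfolding Pbar_def by blast

lemma in_LB: "\<lbrakk>X \<in> LB; x \<in> X\<rbrakk> \<Longrightarrow> x \<in> L \<and> X = line_class x"
  using lclass_eq line_class_eq_iff unfolding Lbar_def by blast

lemma PB_nonempty: "A \<in> PB \<Longrightarrow> \<exists>a. a \<in> A"
  using pclass_eq eqv_refl unfolding Pbar_def by blast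

lemma LB_nonempty: "X \<in> LB \<Longrightarrow> \<exists>x. x \<in> X"
  using lclass_eq leq_refl unfolding Lbar_def by blast

lemma PB_LB: "PB \<inter> LB = {}"
proof (rule equals0I, elim IntE)
  fix A assume "A \<in> PB" "A \<in> LB"
  then obtain a where "a \<in> A" using PB_nonempty by blast
  then have "a \<in> P" "a \<in> L" using in_PB[OF \<open>A \<in> PB\<close>] in_LB[OF \<open>A \<in> LB\<close>] by simp_all
  then show False using disjoint by blast
qed

lemma adjB_sym: "adjB A X \<Longrightarrow> adjB X A"
  using adj_sym unfolding adjbar_def by blast

lemma adjB_sides: "adjB A X \<Longrightarrow> A \<in> PB \<and> X \<in> LB \<or> A \<in> LB \<and> X \<in> PB"
  unfolding adjbar_def by blast

lemma adjB_I:
  assumes "incident a x" shows "adjB (point_class a) (line_class x)"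
proof -
  have "x \<in> L" using assms incident_line by blast
  then have "a \<in> point_class a" "x \<in> line_class x"
    using assms by (simp_all add: pclass_eq lclass_eq)
  then show ?thesis
    unfolding adjbar_def using assms point_class_in line_class_in \<open>x \<in> L\<close> by blast
qed

text \<open>Adjacent classes only promise some adjacent pair; \<open>leq_line_through\<close> moves
  it to the prescribed point \<open>a\<close>.\<close>

lemma adjB_line:
  assumes "A \<in> PB" "adjB A X" "a \<in> A"
  obtains x where "incident a x" "x \<in> L" "X = line_class x"
proof -
  have X: "X \<in> LB" using assms adjB_sides PB_LB by blast
  obtain a0 x0 where 0: "a0 \<in> A" "x0 \<in> X" "adj a0 x0" using assms(2) unfolding adjbar_def by blast
  have a: "a \<in> P" "a0 \<in> P" using in_PB[OF assms(1)] 0 assms(3) by blast+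
  have "point_class a0 = point_class a" using in_PB[OF assms(1)] 0(1) assms(3) by metis
  then have "eqv a0 a" using point_class_eq_iff a by blast
  obtain y where "incident a y" using a point_on_line by blast
  then obtain x where x: "incident a x" "leq x0 x" using leq_line_through[of a0 x0 a y] a 0 \<open>eqv a0 a\<close> by blast
  then have "x \<in> L" using incident_line by blast
  then show ?thesis using that x in_LB[OF X 0(2)] line_class_eq_iff[of x0 x] by blast
qed

text \<open>The counterpart with the line prescribed: \<open>leq_point\<close> carries the adjacent
  point over to \<open>x\<close>.\<close>

lemma adjB_point:
  assumes "A \<in> PB" "adjB A X" "x \<in> X"
  obtains a where "incident a x" "A = point_class a"
proof -
  have X: "X \<in> LB" using assms adjB_sides PB_LB by blast
  obtain a0 x0 where 0: "a0 \<in> A" "x0 \<in> X" "adj a0 x0" using assms(2) unfolding adjbar_def by blast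
  have x: "x \<in> L" "x0 \<in> L" using in_LB[OF X] 0 assms(3) by blast+
  have "line_class x0 = line_class x" using in_LB[OF X] 0(2) assms(3) by metis
  then have "leq x0 x" using line_class_eq_iff x by blast
  have a0: "a0 \<in> P" "A = point_class a0" using in_PB[OF assms(1)] 0 by blast+
  obtain r where "incident r x" using x line_has_point by blast
  then obtain a where a: "incident a x" "eqv a0 a" using leq_point[of x0 x a0 r] \<open>leq x0 x\<close> a0 0 by blast
  then show ?thesis using that a0 point_class_eq_iff[of a0 a] by blast
qed

text \<open>By \<open>opl_transfer\<close>, the existential point and the universal lines in
  \<open>oppbar\<close> may be replaced by any single choice of representatives.\<close>

lemma oppB_point_iff:
  assumes "incident a x" "incident a y"
  shows "oppB (point_class a) (line_class x) (line_class y) \<longleftrightarrow> opp a x y"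
proof -
  have xy: "x \<in> L" "y \<in> L" using assms incident_line by blast+
  have "point_class a \<notin> LB" using point_class_in PB_LB assms by blast
  then have "oppB (point_class a) (line_class x) (line_class y) \<longleftrightarrow>
     (\<exists>b\<in>point_class a. \<forall>u\<in>nbrs adj b \<inter> line_class x. \<forall>v\<in>nbrs adj b \<inter> line_class y. opp b u v)"
    unfolding oppbar_def using adjB_I assms point_class_in by blast
  also have "\<dots> \<longleftrightarrow> opp a x y"
  proof
    assume "\<exists>b\<in>point_class a. \<forall>u\<in>nbrs adj b \<inter> line_class x. \<forall>v\<in>nbrs adj b \<inter> line_class y. opp b u v"
    then obtain b where b: "b \<in> P" "eqv a b"
      and o: "\<And>u v. \<lbrakk>adj b u; adj b v; u \<in> L; v \<in> L; leq x u; leq y v\<rbrakk> \<Longrightarrow> opp b u v"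
      using assms by (auto simp: pclass_eq lclass_eq xy nbrs_def)
    obtain w where w: "incident b w" using b point_on_line by blast
    \<comment> \<open>Lines of both classes do pass through \<open>b\<close>, so the universal
      condition there is not vacuous.\<close>
    obtain u where u: "incident b u" "leq x u" by (rule leq_line_through[OF assms(1) w b(2)])
    obtain v where v: "incident b v" "leq y v" by (rule leq_line_through[OF assms(2) w b(2)])
    have "opp b u v" using o u v incident_line by blast
    then show "opp a x y" using opl_transfer[of b u v a x y] assms b u v eqv_sym leq_sym by blast
  next
    assume o: "opp a x y"
    have "opp a u v" if "u \<in> nbrs adj a \<inter> line_class x" "v \<in> nbrs adj a \<inter> line_class y" for u v
      using opl_transfer[of a x y a u v] that o assms by (auto simp: lclass_eq xy nbrs_def)
    moreover have "a \<in> point_class a" using assms by (simp add: pclass_eq)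
    ultimately show "\<exists>b\<in>point_class a. \<forall>u\<in>nbrs adj b \<inter> line_class x. \<forall>v\<in>nbrs adj b \<inter> line_class y. opp b u v"
      by blast
  qed
  finally show ?thesis .
qed

lemma oppB_adj: "oppB A X Y \<Longrightarrow> adjB A X \<and> adjB A Y"
  by (simp add: oppbar_def)

lemma oppB_line_iff: "A \<in> LB \<Longrightarrow> oppB A X Y \<longleftrightarrow> adjB A X \<and> adjB A Y \<and> X \<noteq> Y"
  using PB_LB unfolding oppbar_def by blast

lemma oppB_point:
  assumes "A \<in> PB" "oppB A X Y" "a \<in> A"
  obtains x y where "incident a x" "incident a y" "x \<in> L" "y \<in> L"
    "X = line_class x" "Y = line_class y" "opp a x y"
proof -
  have XY: "adjB A X" "adjB A Y" using oppB_adj assms(2) by blast+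
  obtain x where x: "incident a x" "x \<in> L" "X = line_class x"
    by (rule adjB_line[OF assms(1) XY(1) assms(3)])
  obtain y where y: "incident a y" "y \<in> L" "Y = line_class y"
    by (rule adjB_line[OF assms(1) XY(2) assms(3)])
  have "A = point_class a" using in_PB assms by blast
  then have "opp a x y" using oppB_point_iff x y assms(2) by blast
  with x y that show ?thesis by blast
qed

lemma oppositionB:
  assumes "A \<in> PB \<union> LB" shows "opposition_rel (nbrs adjB A) (oppB A)"
proof -
  have "oppB A Y X \<and> X \<noteq> Y" if o: "oppB A X Y" for X Y
  proof (cases "A \<in> PB")
    case True
    then obtain a where a: "a \<in> A" using PB_nonempty by blast
    then have A: "a \<in> P" "A = point_class a" using in_PB True by blast+
    obtain x y where xy: "incident a x" "incident a y" "X = line_class x" "Y = line_class y" "opp a x y"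
      using oppB_point[OF True o a] by metis
    then have "opp a y x" using opp_adj A by blast
    then have "oppB A Y X" using oppB_point_iff xy A by blast
    moreover have "\<not> oppB A X X"
    proof -
      have "\<not> opp a x x" using opp_adj A by blast
      then show ?thesis using oppB_point_iff xy A by blast
    qed
    ultimately show ?thesis using o by auto
  next
    case False
    then show ?thesis using assms o oppB_line_iff by auto
  qed
  then show ?thesis unfolding opposition_rel_def nbrs_def using oppB_adj by blast
qed

text \<open>Neighbours of a class lift to neighbours of one fixed representative without increasing
  their number. For a line, the point found stays distinct in the quotient by
  \<open>eqv_on_line_eq\<close>.\<close>

lemma plumpB:
  assumes A: "A \<in> PB \<union> LB" and k: "\<And>v. v \<in> P \<union> L \<Longrightarrow> plump k (nbrs adj v) (opp v)"
  shows "plump k (nbrs adjB A) (oppB A)"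
  unfolding plump_def
proof (intro allI impI, elim conjE)
  fix S assume S: "S \<subseteq> nbrs adjB A" "finite S" "card S \<le> k"
  have lift: "\<exists>z. adj v z \<and> (\<forall>X\<in>S. opp v z (f X))"
    if "v \<in> P \<union> L" "\<And>X. X \<in> S \<Longrightarrow> adj v (f X)" for v f
  proof -
    have "f ` S \<subseteq> nbrs adj v" "finite (f ` S)" "card (f ` S) \<le> k"
      using S that card_image_le[of S f] by (auto simp: nbrs_def)
    then have "\<exists>z\<in>nbrs adj v. \<forall>s\<in>f ` S. opp v z s" using k[OF that(1)] unfolding plump_def by blast
    then show ?thesis by (auto simp: nbrs_def)
  qed
  show "\<exists>Z\<in>nbrs adjB A. \<forall>X\<in>S. oppB A Z X"
  proof (cases "A \<in> PB")
    case True
    then obtain a where a: "a \<in> A" using PB_nonempty by blast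
    then have aP: "a \<in> P" "A = point_class a" using in_PB True by blast+
    have "\<exists>x. incident a x \<and> X = line_class x" if "X \<in> S" for X
    proof -
      have "adjB A X" using S that by (auto simp: nbrs_def)
      then show ?thesis using adjB_line[OF True _ a] by metis
    qed
    then obtain f where f: "\<And>X. X \<in> S \<Longrightarrow> incident a (f X) \<and> X = line_class (f X)" by metis
    then obtain z where z: "adj a z" "\<And>X. X \<in> S \<Longrightarrow> opp a z (f X)" using lift[of a f] aP by blast
    have "oppB A (line_class z) X" if "X \<in> S" for X
      using oppB_point_iff[of a z "f X"] z f[OF that] aP that by auto
    moreover have "adjB A (line_class z)" using adjB_I z aP by simp
    ultimately show ?thesis by (auto simp: nbrs_def)
  next
    case False
    then have LB: "A \<in> LB" using A by blast
    then obtain x where x: "x \<in> A" using LB_nonempty by blast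
    then have xL: "x \<in> L" "A = line_class x" using in_LB LB by blast+
    have "\<exists>a. incident a x \<and> X = point_class a" if "X \<in> S" for X
    proof -
      have "adjB A X" using S that by (auto simp: nbrs_def)
      then have "adjB X A" "X \<in> PB" using adjB_sym adjB_sides False by blast+
      then show ?thesis using adjB_point[OF _ _ x] by metis
    qed
    then obtain f where f: "\<And>X. X \<in> S \<Longrightarrow> incident (f X) x \<and> X = point_class (f X)" by metis
    then obtain z where z: "adj x z" "\<And>X. X \<in> S \<Longrightarrow> opp x z (f X)"
      using lift[of x f] xL adj_sym by blast
    have zx: "incident z x" using z xL adj_sym adj_side by blast
    then have adjz: "adjB A (point_class z)" using adjB_sym adjB_I xL by blast
    have "oppB A (point_class z) X" if "X \<in> S" for X
    proof -
      have "z \<noteq> f X" using z that opp_line xL by blast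
      then have "\<not> eqv z (f X)" using eqv_on_line_eq zx f that by blast
      then have "point_class z \<noteq> X" using point_class_eq_iff[of z "f X"] f[OF that] zx by auto
      moreover have "adjB A X" using S that by (auto simp: nbrs_def)
      ultimately show ?thesis using oppB_line_iff LB adjz by blast
    qed
    with adjz show ?thesis by (auto simp: nbrs_def)
  qed
qed

section \<open>The quotient is a flat green quadrangle\<close>

text \<open>The quotient root is lifted from its middle: a point \<open>b\<close>, then lines of
  \<open>X\<close> and \<open>Y\<close> on \<open>b\<close>, then points of \<open>A\<close> and
  \<open>C\<close> on these. The ends need only be equivalent to \<open>a\<close> and
  \<open>c\<close>.\<close>

lemma farB:
  assumes "a \<in> P" "c \<in> P" "A = point_class a" "C = point_class c"
    and "adjB A X" "A \<noteq> B" "B \<in> PB" "oppB B X Y" "adjB C Y" "C \<noteq> B"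
  shows "far a c"
proof -
  have PB: "A \<in> PB" "C \<in> PB" using assms point_class_in by blast+
  obtain b where "b \<in> B" using PB_nonempty assms by blast
  then have b: "b \<in> P" "B = point_class b" using in_PB assms by blast+
  obtain x y where xy: "incident b x" "incident b y" "x \<in> L" "y \<in> L" "X = line_class x" "Y = line_class y" "opp b x y"
    by (rule oppB_point[OF assms(7,8) \<open>b \<in> B\<close>])
  have "x \<in> X" "y \<in> Y" using xy by (simp_all add: lclass_eq)
  obtain a' where a': "incident a' x" "A = point_class a'"
    by (rule adjB_point[OF PB(1) assms(5) \<open>x \<in> X\<close>])
  obtain c' where c': "incident c' y" "C = point_class c'"
    by (rule adjB_point[OF PB(2) assms(9) \<open>y \<in> Y\<close>])
  have "a' \<noteq> b" "c' \<noteq> b" using assms b a' c' by auto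
  then have "far a' c'" using farI[of b x y a' c'] a' c' xy b by blast
  moreover have "eqv a' a" "eqv c' c"
    using a' c' assms point_class_eq_iff[of a' a] point_class_eq_iff[of c' c] by simp_all
  ultimately show ?thesis using eqv_far by blast
qed

lemma not_farB:
  assumes "a \<in> P" "c \<in> P" "adjB (point_class a) X" "adjB (point_class c) X"
  shows "\<not> far a c"
proof -
  have PB: "point_class a \<in> PB" "point_class c \<in> PB" using assms point_class_in by blast+
  then have "X \<in> LB" using assms adjB_sides PB_LB by blast
  then obtain x where x: "x \<in> X" using LB_nonempty by blast
  obtain a' where a': "incident a' x" "point_class a = point_class a'"
    by (rule adjB_point[OF PB(1) assms(3) x])
  obtain c' where c': "incident c' x" "point_class c = point_class c'"
    by (rule adjB_point[OF PB(2) assms(4) x])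
  have "eqv a' a" "eqv c' c"
    using a' c' assms point_class_eq_iff[of a' a] point_class_eq_iff[of c' c] by simp_all
  moreover have "col a' c'" unfolding col_def using a' c' by blast
  then have "\<not> far a' c'" by (rule col_not_far)
  ultimately show ?thesis using eqv_far by blast
qed

lemma PB_E:
  assumes "A \<in> PB" obtains a where "a \<in> P" "A = point_class a" "a \<in> A"
  using PB_nonempty in_PB assms by blast

lemma LB_E:
  assumes "X \<in> LB" obtains x where "x \<in> L" "X = line_class x" "x \<in> X"
  using LB_nonempty in_LB assms by blast

text \<open>Since \<open>far\<close> depends only on classes, paths in the quotient can be tested in
  \<Gamma> by \<open>farB\<close> and \<open>not_farB\<close>; the axioms about opposites come from
  \<open>plumpB\<close>.\<close>

theorem quotient_geometry:
  "straight_geometry (\<lambda>A X. A \<in> PB \<and> adjB A X) (\<lambda>A X Y. A \<in> PB \<and> oppB A X Y)"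
proof
  have opp: "oppB A Y X" "X \<noteq> Y" if "A \<in> PB" "oppB A X Y" for A X Y
    using oppositionB[of A] that unfolding opposition_rel_def by blast+
  have uniq: "X = Y" if on: "A \<in> PB" "adjB A X" "B \<in> PB" "adjB B X" "adjB A Y" "adjB B Y" "A \<noteq> B" for A B X Y
  proof -
    have "X \<in> LB" "Y \<in> LB" using on adjB_sides PB_LB by blast+
    obtain x where x: "x \<in> L" "X = line_class x" "x \<in> X" by (rule LB_E[OF \<open>X \<in> LB\<close>])
    obtain y where y: "y \<in> L" "Y = line_class y" "y \<in> Y" by (rule LB_E[OF \<open>Y \<in> LB\<close>])
    obtain a where a: "incident a x" "A = point_class a" by (rule adjB_point[OF on(1,2) x(3)])
    obtain b where b: "incident b x" "B = point_class b" by (rule adjB_point[OF on(3,4) x(3)])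
    obtain a' where a': "incident a' y" "A = point_class a'" by (rule adjB_point[OF on(1,5) y(3)])
    obtain b' where b': "incident b' y" "B = point_class b'" by (rule adjB_point[OF on(3,6) y(3)])
    have "a \<noteq> b" using a b on(7) by blast
    moreover have "eqv a a'" "eqv b b'"
      using a b a' b' point_class_eq_iff[of a a'] point_class_eq_iff[of b b'] by simp_all
    ultimately have "leq x y" using leqI[of a x b a' y b'] a b a' b' by blast
    then show ?thesis using line_class_eq_iff x y by blast
  qed
  show "A \<in> PB \<and> adjB A X" if "A \<in> PB \<and> oppB A X Y" for A X Y using that oppB_adj by blast
  show "A \<in> PB \<and> oppB A Y X" if "A \<in> PB \<and> oppB A X Y" for A X Y using that opp by blast
  show "\<not> (A \<in> PB \<and> oppB A X X)" for A X using opp by blast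
  fix A X assume AX: "A \<in> PB \<and> adjB A X"
  {
    fix B Y assume "B \<in> PB \<and> adjB B X" "A \<in> PB \<and> adjB A Y" "B \<in> PB \<and> adjB B Y" "A \<noteq> B"
    then show "X = Y" using uniq[of A X B Y] AX by blast
  next
    fix B Y X' B' assume p: "A \<noteq> B" "B \<in> PB \<and> oppB B X Y" "A \<in> PB \<and> adjB A X'" "A \<noteq> B'" "B' \<in> PB \<and> oppB B' X' Y"
    obtain a where a: "a \<in> P" "A = point_class a" by (rule PB_E[of A]) (use AX in auto)
    obtain b' where b': "b' \<in> P" "B' = point_class b'" by (rule PB_E[of B']) (use p in auto)
    have adj: "adjB B' Y" "adjB B' X'" using oppB_adj p by blast+
    have "\<not> far a b'" using not_farB[of a b' X'] a b' p adj by blast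
    \<comment> \<open>Otherwise \<open>A X B Y B'\<close> would be a root, although \<open>A\<close>
      and \<open>B'\<close> lie on the common line \<open>X'\<close>.\<close>
    then show "B = B'" using farB[of a b' A B' X B Y] a b' AX p adj by blast
  next
    fix B assume B: "B \<in> PB \<and> adjB B X"
    have "X \<in> LB" using AX adjB_sides PB_LB by blast
    then have "plump 2 (nbrs adjB X) (oppB X)" using plumpB plump_nbrs by blast
    moreover have "{A, B} \<subseteq> nbrs adjB X" "finite {A, B}" "card {A, B} \<le> 2"
      using AX B adjB_sym by (auto simp: nbrs_def card_insert_if)
    ultimately have "\<exists>C\<in>nbrs adjB X. \<forall>D\<in>{A, B}. oppB X C D" unfolding plump_def by meson
    then obtain C where "C \<in> nbrs adjB X" "oppB X C A" "oppB X C B" by blast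
    then have "adjB C X" "C \<noteq> A" "C \<noteq> B" using \<open>X \<in> LB\<close> oppB_line_iff adjB_sym by (auto simp: nbrs_def)
    moreover from this have "C \<in> PB" using adjB_sides \<open>X \<in> LB\<close> PB_LB by blast
    ultimately show "\<exists>C. (C \<in> PB \<and> adjB C X) \<and> C \<noteq> A \<and> C \<noteq> B" by blast
  next
    fix Y assume Y: "A \<in> PB \<and> adjB A Y"
    have "plump 2 (nbrs adjB A) (oppB A)" using plumpB plump_nbrs AX by blast
    moreover have "{X, Y} \<subseteq> nbrs adjB A" "finite {X, Y}" "card {X, Y} \<le> 2"
      using AX Y by (auto simp: nbrs_def card_insert_if)
    ultimately have "\<exists>Z\<in>nbrs adjB A. \<forall>D\<in>{X, Y}. oppB A Z D" unfolding plump_def by meson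
    then obtain Z where "oppB A Z X" "oppB A Z Y" by blast
    then show "\<exists>Z. (A \<in> PB \<and> oppB A X Z) \<and> A \<in> PB \<and> oppB A Y Z" using opp AX by blast
  next
    fix B Y C Z assume p: "A \<noteq> B" "B \<in> PB \<and> oppB B X Y" "C \<in> PB \<and> adjB C Y" "B \<noteq> C" "C \<in> PB \<and> oppB C Y Z"
    obtain a where a: "a \<in> P" "A = point_class a" "a \<in> A" by (rule PB_E[of A]) (use AX in auto)
    obtain c where c: "c \<in> P" "C = point_class c" "c \<in> C" by (rule PB_E[of C]) (use p in auto)
    obtain x where x: "incident a x" "x \<in> L" "X = line_class x"
      by (rule adjB_line[of A X a]) (use AX a in auto)
    obtain z where z: "incident c z" "z \<in> L" "Z = line_class z"
      by (rule adjB_line[of C Z c]) (use p c oppB_adj in auto)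
    have ac: "far a c" using farB[of a c A C X B Y] a c AX p by blast
    \<comment> \<open>The two missing vertices are the classes of the projection \<open>s\<close> of
      \<open>a\<close> to \<open>z\<close> and of the line \<open>w\<close> joining them;
      \<open>far a c\<close> makes the path through \<open>s\<close> straight.\<close>
    obtain s where s: "incident s z" "col s a" by (rule projection_exists[OF x(1) z(1)])
    obtain w where w: "incident s w" "incident a w" using s by (auto simp: col_def)
    have wL: "w \<in> L" using w incident_line by blast
    have ne: "\<not> eqv s a" "\<not> eqv s c"
    proof -
      have "\<not> far s c" using s z col_not_far by (auto simp: col_def)
      then show "\<not> eqv s a" using ac by (auto simp: eqv_def)
      have "\<not> far s a" using s col_not_far by blast
      then show "\<not> eqv s c" using ac far_sym by (auto simp: eqv_def)
    qed
    define D W where "D = point_class s" "W = line_class w"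
    have "opp s z w" using far_straight[of c a z s w] far_sym[OF ac] z s w by blast
    then have D: "D \<in> PB" "oppB D Z W" using oppB_point_iff z s w point_class_in D_W_def by auto
    have "adjB D Z" using oppB_adj D by blast
    have DA: "D \<noteq> A" "D \<noteq> C" using ne s a c point_class_eq_iff D_W_def by auto
    obtain b where b: "b \<in> P" "B = point_class b" by (rule PB_E[of B]) (use p in auto)
    have adj: "adjB B X" "adjB B Y" using p oppB_adj by blast+
    \<comment> \<open>The path \<open>B Y C Z D\<close> is a root. Hence \<open>s\<close> is
      opposite the point \<open>b'\<close> of \<open>B\<close> on \<open>x\<close>, which makes
      \<open>w\<close> and \<open>x\<close> opposite at \<open>a\<close>.\<close>
    have "far b s"
      using farB[of b s B D Y C Z] b s p adj D_W_def \<open>adjB D Z\<close> DA by blast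
    obtain b' where b': "incident b' x" "B = point_class b'"
      by (rule adjB_point[of B X x]) (use p adj x in \<open>auto simp: lclass_eq\<close>)
    have "eqv b b'" using b b' point_class_eq_iff[of b b'] by simp
    then have "far s b'" using \<open>far b s\<close> far_sym by (auto simp: eqv_def)
    then have "opp a w x" using far_straight[of s b' w a x] w x b' by blast
    then have "oppB A W X" using oppB_point_iff[of a w x] w x a D_W_def by simp
    then show "\<exists>D W. D \<noteq> A \<and> D \<noteq> C \<and> (D \<in> PB \<and> oppB D Z W) \<and> A \<in> PB \<and> oppB A W X"
      using D DA AX by blast
  next
    fix C Y assume CY: "C \<in> PB \<and> adjB C Y"
    let ?R = "\<lambda>A B. \<exists>Z. (A \<in> PB \<and> adjB A Z) \<and> B \<in> PB \<and> adjB B Z"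
    obtain a where a: "a \<in> P" "A = point_class a" "a \<in> A" by (rule PB_E[of A]) (use AX in auto)
    obtain c where c: "c \<in> P" "C = point_class c" "c \<in> C" by (rule PB_E[of C]) (use CY in auto)
    obtain x where x: "incident a x" using a point_on_line by blast
    obtain y where y: "incident c y" using c point_on_line by blast
    obtain s where s: "incident s y" "col s a" by (rule projection_exists[OF x y])
    then obtain z where "incident s z" "incident a z" by (auto simp: col_def)
    then have "?R A (point_class s)" using adjB_I point_class_in a by blast
    moreover have "?R (point_class s) C" using adjB_I point_class_in c s y by blast
    ultimately show "?R\<^sup>*\<^sup>* A C"
      by (rule rtranclp.rtrancl_into_rtrancl[OF r_into_rtranclp[of ?R]])
  }
qed

theorem quotient_green_quadrangle: "green_quadrangle PB LB adjB oppB"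
proof (rule green_quadrangle.intro)
  show "green adjB oppB LB"
    unfolding green_def trivial_rel_def nbrs_def using oppB_line_iff by blast
  show "PB \<union> LB \<noteq> {}" using nonempty by (auto simp: Pbar_def Lbar_def)
  show "straight_geometry (\<lambda>A X. A \<in> PB \<and> adjB A X) (\<lambda>A X Y. A \<in> PB \<and> oppB A X Y)"
    by (rule quotient_geometry)
qed (use adjB_sym adjB_sides PB_LB oppositionB plumpB plump_nbrs in \<open>blast+\<close>)

text \<open>Opposition of point classes is opposition of representatives, so passing to classes a
  second time identifies nothing further; \<open>flatI\<close> takes care of lines.\<close>

theorem quotient_flat: "flat (PB \<union> LB) adjB oppB 4"
proof -
  interpret bar: green_quadrangle PB LB adjB oppB by (rule quotient_green_quadrangle)
  have far_iff: "bar.far (point_class a) (point_class c) \<longleftrightarrow> far a c" if ac: "a \<in> P" "c \<in> P" for a c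
  proof
    assume "bar.far (point_class a) (point_class c)"
    then show "far a c" unfolding bar.far_def using farB ac by blast
  next
    assume "far a c"
    then obtain x b y where p: "incident a x" "a \<noteq> b" "b \<in> P" "opp b x y" "incident c y" "c \<noteq> b"
      unfolding far_def by blast
    have b: "incident b x" "incident b y" using p opp_adj by blast+
    \<comment> \<open>Distinct points of one line are never equivalent, so the root does not
      collapse.\<close>
    have "point_class a \<noteq> point_class b" "point_class c \<noteq> point_class b"
      using eqv_on_line_eq[of a x b] eqv_on_line_eq[of c y b] point_class_eq_iff[of a b] point_class_eq_iff[of c b]
        p b by blast+
    moreover have "oppB (point_class b) (line_class x) (line_class y)"
      using oppB_point_iff b p by blast
    ultimately show "bar.far (point_class a) (point_class c)"
      using bar.farI[of "point_class b" "line_class x" "line_class y"] adjB_I p point_class_in by blast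
  qed
  show ?thesis
  proof (rule bar.flatI)
    fix A C assume AC: "A \<in> PB" "C \<in> PB" "bar.eqv A C"
    obtain a where a: "a \<in> P" "A = point_class a" by (rule PB_E[OF AC(1)])
    obtain c where c: "c \<in> P" "C = point_class c" by (rule PB_E[OF AC(2)])
    have "far a r \<longleftrightarrow> far c r" for r
    proof (cases "r \<in> P")
      case True
      have "bar.far A (point_class r) \<longleftrightarrow> bar.far C (point_class r)"
        using AC(3) by (simp add: bar.eqv_def)
      then show ?thesis using far_iff[OF _ True] a c by simp
    next
      case False
      then show ?thesis using far_point by blast
    qed
    then have "eqv a c" by (simp add: eqv_def)
    then show "A = C" using point_class_eq_iff a c by blast
  qed
qed

end

theorem mainTheorem14:
  fixes V P L :: "'v set" and adj :: "'v \<Rightarrow> 'v \<Rightarrow> bool" and opp :: "'v \<Rightarrow> 'v \<Rightarrow> 'v \<Rightarrow> bool"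
  assumes "veldkamp_quadrangle V adj opp P L"
    and "green adj opp L"
  shows "veldkamp_quadrangle (Vbar V adj opp P L) (adjbar V adj opp P L) (oppbar V adj opp P L)
           (Pbar V adj opp P) (Lbar V adj opp P L)
       \<and> green (adjbar V adj opp P L) (oppbar V adj opp P L) (Lbar V adj opp P L)
       \<and> flat (Vbar V adj opp P L) (adjbar V adj opp P L) (oppbar V adj opp P L) 4
       \<and> (flat V adj opp 4 \<longleftrightarrow>
            (\<forall>a\<in>P. pclass V adj opp P a = {a}) \<and> (\<forall>x\<in>L. lclass V adj opp P L x = {x}))
       \<and> (\<forall>k\<ge>3. plump_graph k V adj opp \<longrightarrow>
            plump_graph k (Vbar V adj opp P L) (adjbar V adj opp P L) (oppbar V adj opp P L))"
proof -
  interpret green_quadrangle P L adj opp by (rule veldkamp_quadrangle_geometry[OF assms])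
  \<comment> \<open>With the quotient as a second instance, \<open>bar.veldkamp_quadrangle\<close>
    translates its geometry back to the Veldkamp axioms.\<close>
  interpret bar: green_quadrangle PB LB adjB oppB by (rule quotient_green_quadrangle)
  have V: "V = P \<union> L" using assms(1) by (auto simp: veldkamp_quadrangle_def)
  have "plump_graph k (PB \<union> LB) adjB oppB" if "plump_graph k (P \<union> L) adj opp" for k
    using plumpB that unfolding plump_graph_def by blast
  then show ?thesis
    unfolding V Vbar_def
    using bar.veldkamp_quadrangle bar.is_green quotient_flat flat_iff_singletons by blast
qed

end
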